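(* There exists $N$ such that for all integers $n\ge N$ and all integers $k$ with $1\le k\leq n^{0.25}$ the following holds: if $\mathcal{F}\subset \mathrm{Sym}(n,k)$ is an intersecting family, then \[|\mathcal{F}| \leq \max\left\{ \mathrm{c}(n-1,k),\ \mathrm{c}(n-1,k-1) \right\}.\] Moreover, equality holds if and only if $\mathcal{F}=\{\rho \in \mathrm{Sym}(n,k):\ \rho(i)=j\}$ for some $i,j \in [n]$ such that $\mathrm{c}(n-1,k-\delta_{i,j})=\max\left\{ \mathrm{c}(n-1,k),\ \mathrm{c}(n-1,k-1) \right\}$, where $\delta_{i,j}$ is the Kronecker delta.
   Context: $[n]=\{1,\dots,n\}$; $\mathrm{Sym}(n)$ is the set of all permutations of $[n]$. $\mathrm{Sym}(n,k)$ is the set of permutations in $\mathrm{Sym}(n)$ with exactly $k$ cycles in their cycle decomposition (fixed points count as cycles). $\mathrm{c}(m,l)$ is the unsigned Stirling number of the first kind, i.e. the number of permutations of $[m]$ with exactly $l$ cycles; in particular $\mathrm{c}(m,0)=0$ for $m>0$. A family $\mathcal{F}\subset\mathrm{Sym}(n,k)$ is intersecting if for all $\sigma,\tau\in\mathcal{F}$ there is $i\in[n]$ with $\sigma(i)=\tau(i)$. *)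

theory Defs
  imports Complex_Main "HOL-Combinatorics.Orbits" "HOL-Combinatorics.Stirling"
begin

text \<open>The cycles of a permutation \<open>p\<close> of a finite set \<open>S\<close> are counted by their supports, which are
  the sets \<open>orbit p x\<close> for \<open>x \<in> S\<close>. A fixed point \<open>x\<close> contributes the cycle \<open>{x}\<close>.\<close>

definition num_cycles_on :: "'a set \<Rightarrow> ('a \<Rightarrow> 'a) \<Rightarrow> nat" where
  "num_cycles_on S p = card (orbit p ` S)"

text \<open>Being functions on all of \<open>nat\<close>, the elements of \<open>Sym(n,k)\<close> are the identity outside \<open>{1..n}\<close>.\<close>

definition Sym_cycles :: "nat \<Rightarrow> nat \<Rightarrow> (nat \<Rightarrow> nat) set" where
  "Sym_cycles n k = {p. p permutes {1..n} \<and> num_cycles_on {1..n} p = k}"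

definition intersecting_family :: "nat \<Rightarrow> (nat \<Rightarrow> nat) set \<Rightarrow> bool" where
  "intersecting_family n F \<longleftrightarrow> (\<forall>\<sigma>\<in>F. \<forall>\<tau>\<in>F. \<exists>i\<in>{1..n}. \<sigma> i = \<tau> i)"

lemma orbit_transpose_comp:
  assumes p: "p permutes S" and fin: "finite S" and a: "a \<notin> S" and b: "b \<in> S" and x: "x \<in> S"
  defines "q \<equiv> transpose a b \<circ> p"
  shows "orbit q x = (if b \<in> orbit p x then insert a (orbit p x) else orbit p x)"
proof -
  have pS: "p z \<in> S \<longleftrightarrow> z \<in> S" for z using permutes_in_image[OF p] .
  have pa: "p a = a" using p a by (simp add: permutes_not_in)
  have ab: "a \<noteq> b" using a b by auto
  have sub: "orbit p x \<subseteq> S" using permutes_orbit_subset[OF p x] .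
  have qa: "q a = b" by (simp add: q_def pa)
  have qb: "q z = a" if "p z = b" for z using that by (simp add: q_def)
  have qo: "q z = p z" if "z \<in> S" "p z \<noteq> b" for z
    using that a pS[of z] by (metis comp_apply q_def transpose_apply_other)
  have 1: "orbit p x \<subseteq> orbit q x"
  proof
    fix y assume "y \<in> orbit p x" then show "y \<in> orbit q x"
    proof induction
      case base
      show ?case
      proof (cases "p x = b")
        case True
        then have "a \<in> orbit q x" using orbit.base[of q x] qb[OF True] by simp
        then show ?thesis using orbit.step[of a q x] qa True by simp
      next
        case False then show ?thesis using orbit.base[of q x] qo[OF x] by simp
      qed
    next
      case (step y)
      have yS: "y \<in> S" using step sub by auto
      show ?case
      proof (cases "p y = b")
        case True
        then have "a \<in> orbit q x" using orbit.step[OF step.IH] qb[OF True] by simp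
        then show ?thesis using orbit.step[of a q x] qa True by simp
      next
        case False then show ?thesis using orbit.step[OF step.IH] qo[OF yS] by simp
      qed
    qed
  qed
  have 2: "a \<in> orbit q x" if "b \<in> orbit p x"
    using that
  proof cases
    case base then show ?thesis using orbit.base[of q x] qb by metis
  next
    case (step y) then show ?thesis using orbit.step[of y q x] 1 qb by (metis subsetD)
  qed
  have 3: "y \<in> (if b \<in> orbit p x then insert a (orbit p x) else orbit p x)"
    if "y \<in> orbit q x" for y
    using that
  proof induction
    case base
    have "p x \<in> orbit p x" by (rule orbit.base)
    then show ?case using qb[of x] qo[OF x] by (cases "p x = b") auto
  next
    case (step y)
    show ?case
    proof (cases "y = a")
      case True
      then have "b \<in> orbit p x" using step.IH sub a by (auto split: if_splits)
      then show ?thesis using True qa by simp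
    next
      case False
      then have y: "y \<in> orbit p x" using step.IH by (auto split: if_splits)
      then have "p y \<in> orbit p x" by (rule orbit.step)
      moreover have "y \<in> S" using y sub by auto
      ultimately show ?thesis using qb[of y] qo[of y] by (cases "p y = b") auto
    qed
  qed
  show ?thesis
  proof (rule equalityI)
    show "orbit q x \<subseteq> (if b \<in> orbit p x then insert a (orbit p x) else orbit p x)"
      using 3 by (rule subsetI)
  qed (use 1 2 in auto)
qed

lemma num_cycles_on_transpose_comp:
  assumes p: "p permutes S" and fin: "finite S" and a: "a \<notin> S" and b: "b \<in> insert a S"
  shows "num_cycles_on (insert a S) (transpose a b \<circ> p) =
    (if b = a then Suc (num_cycles_on S p) else num_cycles_on S p)"
proof -
  have sub: "orbit p x \<subseteq> S" if "x \<in> S" for x using permutes_orbit_subset[OF p that] .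
  show ?thesis
  proof (cases "b = a")
    case True
    have "p a = a" using p a by (simp add: permutes_not_in)
    then have "a \<in> orbit p a" using orbit.base[of p a] by simp
    then have "orbit p a \<notin> orbit p ` S" using sub a by blast
    then show ?thesis using True fin by (simp add: num_cycles_on_def)
  next
    case False
    define q where "q = transpose a b \<circ> p"
    define g where "g C = (if b \<in> C then insert a C else C)" for C
    have bS: "b \<in> S" using b False by simp
    have q: "q permutes insert a S" unfolding q_def
      by (intro permutes_compose permutes_swap_id permutes_subset[OF p]) (use bS in auto)
    have orb: "orbit q x = g (orbit p x)" if "x \<in> S" for x
      using orbit_transpose_comp[OF p fin a bS that] by (simp add: q_def g_def)
    have "q a = b" using p a by (simp add: q_def permutes_not_in)
    then have "b \<in> orbit q a" using orbit.base[of q a] by simp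
    moreover have "permutation q" using q fin by (auto simp: permutation_permutes)
    ultimately have "orbit q a = orbit q b"
      using permutation_orbit_step[of q a] \<open>q a = b\<close> by simp
    then have "orbit q ` insert a S = orbit q ` S" using bS by auto
    also have "\<dots> = g ` (orbit p ` S)" using orb by (auto simp: image_image)
    finally have "card (orbit q ` insert a S) = card (g ` (orbit p ` S))" by simp
    also have "\<dots> = card (orbit p ` S)"
    proof (rule card_image, rule inj_onI)
      fix C D assume "C \<in> orbit p ` S" "D \<in> orbit p ` S" "g C = g D"
      moreover have "a \<notin> C" "a \<notin> D" using calculation sub a by auto
      ultimately show "C = D" using False unfolding g_def
        by (auto split: if_splits dest: insert_ident)
    qed
    finally show ?thesis using False by (simp add: num_cycles_on_def q_def)
  qed
qed

text \<open>\<open>stirling m l\<close> is defined by recursion in the library; it is the number of permutations of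
  \<open>{1..m}\<close> with exactly \<open>l\<close> cycles.\<close>

lemma card_Sym_cycles: "card (Sym_cycles m l) = stirling m l"
proof (induction m arbitrary: l)
  case 0
  have "Sym_cycles 0 l = (if l = 0 then {id} else {})"
    by (auto simp: Sym_cycles_def num_cycles_on_def)
  then show ?case by (cases l) auto
next
  case (Suc m)
  let ?S = "{1..m}" and ?a = "Suc m"
  let ?f = "\<lambda>(b, p). transpose ?a b \<circ> p"
  let ?P = "{p. p permutes ?S}"
  have ins: "{1..Suc m} = insert ?a ?S" by auto
  have cyc: "num_cycles_on (insert ?a ?S) (transpose ?a b \<circ> p) =
      (if b = ?a then Suc (num_cycles_on ?S p) else num_cycles_on ?S p)"
    if "b \<in> insert ?a ?S" "p permutes ?S" for b p
    using num_cycles_on_transpose_comp[OF that(2) _ _ that(1)] by simp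
  have "{p. p permutes insert ?a ?S} = ?f ` (insert ?a ?S \<times> ?P)"
    unfolding permutes_insert by (rule arg_cong[where f = "image _"]) auto
  then have "Sym_cycles (Suc m) l =
      {q \<in> ?f ` (insert ?a ?S \<times> ?P). num_cycles_on (insert ?a ?S) q = l}"
    unfolding Sym_cycles_def ins by blast
  also have "\<dots> = ?f ` {x \<in> insert ?a ?S \<times> ?P. num_cycles_on (insert ?a ?S) (?f x) = l}"
    by blast
  also have "{x \<in> insert ?a ?S \<times> ?P. num_cycles_on (insert ?a ?S) (?f x) = l} =
      {?a} \<times> {p \<in> ?P. Suc (num_cycles_on ?S p) = l} \<union> ?S \<times> Sym_cycles m l"
    (is "_ = ?A \<union> ?B")
  proof (rule set_eqI, clarify)
    fix b p
    show "(b, p) \<in> {x \<in> insert ?a ?S \<times> ?P. num_cycles_on (insert ?a ?S) (?f x) = l} \<longleftrightarrow>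
        (b, p) \<in> ?A \<union> ?B"
    proof (cases "b \<in> insert ?a ?S \<and> p permutes ?S")
      case True
      then show ?thesis
        using cyc[of b p] by (cases "b = ?a") (auto simp: Sym_cycles_def)
    next
      case False
      then show ?thesis by (auto simp: Sym_cycles_def)
    qed
  qed
  finally have eq: "Sym_cycles (Suc m) l = ?f ` (?A \<union> ?B)" .
  have "inj_on ?f (?A \<union> ?B)"
  proof (rule inj_onI, clarify)
    fix b p c q
    assume *: "(b, p) \<in> ?A \<union> ?B" "(c, q) \<in> ?A \<union> ?B" "transpose ?a b \<circ> p = transpose ?a c \<circ> q"
    have "p permutes ?S" "q permutes ?S" using * by (auto simp: Sym_cycles_def)
    then have "p ?a = ?a" "q ?a = ?a" by (auto simp: permutes_not_in)
    then have "b = c" using fun_cong[OF *(3), of ?a] by simp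
    moreover have "p = q" using *(3) \<open>b = c\<close>
      by (metis comp_assoc comp_id transpose_comp_involutory id_comp)
    ultimately show "b = c \<and> p = q" by simp
  qed
  then have "card (Sym_cycles (Suc m) l) = card (?A \<union> ?B)" by (simp add: eq card_image)
  also have "\<dots> = card ?A + card ?B"
  proof (rule card_Un_disjoint)
    have fP: "finite ?P" by (rule finite_permutations) simp
    show "finite ?A" using fP by simp
    show "finite ?B" by (rule finite_cartesian_product, simp,
        rule finite_subset[OF _ fP]) (auto simp: Sym_cycles_def)
    show "?A \<inter> ?B = {}" by auto
  qed
  also have "\<dots> = stirling (Suc m) l"
  proof (cases l)
    case 0
    then show ?thesis using Suc.IH[of 0] by (cases m) (auto simp: card_cartesian_product)
  next
    case (Suc l')
    have "{p \<in> ?P. Suc (num_cycles_on ?S p) = l} = Sym_cycles m l'"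
      using Suc by (auto simp: Sym_cycles_def)
    then show ?thesis using Suc.IH Suc by (simp add: card_cartesian_product)
  qed
  finally show ?case .
qed

end

theory Submission
  imports Defs "HOL-Library.FuncSet" "HOL-Real_Asymp.Real_Asymp"
begin

text \<open>A permutation is identified with its graph, so that \<open>Sym(n,k)\<close> becomes a family
  of \<open>n\<close>-element sets. Contracting prescribed values and comparing consecutive Stirling
  numbers shows that at most a fraction \<open>s\<close> to the power \<open>-\<bar>X\<bar>\<close> of
  its members contain a given set \<open>X\<close>, where \<open>s\<close> is \<open>n powr 0.7\<close>.
  An intersecting subfamily \<open>F\<close> is decomposed greedily into pieces that are \<open>n powr
  0.6\<close>-spread around small centres. Two spread families always have disjoint members, as a random
  half of the ground set contains a member of the first, and its complement a member of the second, each
  with probability above 1/2; hence the centres intersect pairwise. If they have no common point,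
  \<open>F\<close> is too small, since almost every member contains one of boundedly many pairs.
  Otherwise \<open>F\<close> lies in a star up to very few exceptions. A single exception
  \<open>\<sigma>\<close> already excludes all permutations of the star that agree with
  \<open>\<sigma>\<close> nowhere, and inserting the points one at a time shows that these form a
  fraction of order at least \<open>1/n\<^sup>2\<close> of the star, which is more than all exceptions
  together.\<close>

section \<open>Fragments and colourings\<close>

text \<open>Where the exponents come from. Call a fragment short if it has at most \<open>t\<close>
  points. Long fragments are rare in the first round only if \<open>n / r\<close> is far below
  \<open>t\<close>, and the second round works only if \<open>t\<close> is far below
  \<open>r\<close>; so \<open>r\<close> must exceed the square root of \<open>n\<close>. A single
  round would need \<open>r\<close> above \<open>n\<close>, but some value at a given point is taken
  by at least \<open>1 / n\<close> of the permutations, so no spread beyond \<open>n\<close> is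
  available. The pairs make up a fraction of order \<open>1 / s^2\<close>, to be compared with a
  star of fraction at least \<open>1 / n\<close>, so \<open>s\<close> must exceed the square root of
  \<open>n\<close> too. From above, forgetting a fixed point lowers the number of cycles, and
  \<open>c(m, k - 1)\<close> is only bounded by \<open>2 * k * c(m, k)\<close>; this yields a spread
  of order \<open>n / k\<close>, at least n^(3/4) for the given range of \<open>k\<close>. The
  exponents 0.5, 0.6, 0.7 and 0.74 are placed between these limits. The gap between \<open>r\<close>
  and \<open>s\<close> pays for the exceptions: each point of a centre costs a factor
  \<open>r / s\<close>, and 40 points bring this down to n^(-4), below the n^(-3) that is lost to a
  single exception.\<close>

definition containing :: "'a set set \<Rightarrow> 'a set \<Rightarrow> 'a set set" where
  "containing F X = {S \<in> F. X \<subseteq> S}"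

text \<open>\<open>K = 1\<close> is the usual spreadness. The slack is there because the links in
  \<open>spread_link\<close> keep only half of the members.\<close>

definition spread :: "real \<Rightarrow> real \<Rightarrow> 'a set set \<Rightarrow> bool" where
  "spread K r P \<longleftrightarrow> (\<forall>X. r ^ card X * real (card (containing P X)) \<le> K * real (card P))"

text \<open>These are the minimum fragments known from work on the Kahn-Kalai conjecture. For
  \<open>S\<close> in \<open>H\<close> the minimum is over a nonempty collection, as
  \<open>S\<close> itself competes.\<close>

definition fragment :: "'a set set \<Rightarrow> 'a set \<Rightarrow> 'a set \<Rightarrow> 'a set" where
  "fragment H W S =
    (ARG_MIN (\<lambda>R. card (R - W)) R. R \<in> H \<and> R \<subseteq> W \<union> S) - W"

lemma fragment_obtains:
  assumes "S \<in> H"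
  obtains R where "R \<in> H" "R \<subseteq> W \<union> S" "fragment H W S = R - W"
    "\<And>R'. R' \<in> H \<Longrightarrow> R' \<subseteq> W \<union> S \<Longrightarrow> card (R - W) \<le> card (R' - W)"
proof
  let ?P = "\<lambda>R. R \<in> H \<and> R \<subseteq> W \<union> S"
  let ?R = "ARG_MIN (\<lambda>R. card (R - W)) R. ?P R"
  have S: "?P S" using assms by auto
  have "?P ?R" using arg_min_natI[of ?P S] S by blast
  then show "?R \<in> H" "?R \<subseteq> W \<union> S" by auto
  show "fragment H W S = ?R - W" by (simp add: fragment_def)
  show "card (?R - W) \<le> card (R' - W)" if "R' \<in> H" "R' \<subseteq> W \<union> S" for R'
    by (rule arg_min_nat_le) (use that in auto)
qed

lemma fragment_subset: "S \<in> H \<Longrightarrow> fragment H W S \<subseteq> S - W"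
  by (erule fragment_obtains[of _ _ W]) auto

lemma fragment_empty_imp: "S \<in> H \<Longrightarrow> fragment H W S = {} \<Longrightarrow> \<exists>R\<in>H. R \<subseteq> W"
  by (erule fragment_obtains[of _ _ W]) auto

lemma ex_subset_Un_fragment: "S \<in> H \<Longrightarrow> \<exists>R\<in>H. R \<subseteq> W \<union> fragment H W S"
  by (erule fragment_obtains[of _ _ W]) auto

text \<open>\<open>R\<close> competes in the minimisation, because it lies below
  \<open>W \<union> S\<close>, and \<open>R - W\<close> lies inside the fragment. As the fragment
  has the least possible size, the two coincide.\<close>

lemma fragment_subset_witness:
  assumes "S \<in> H" "R \<in> H" "R \<subseteq> W \<union> fragment H W S" "finite S"
  shows "fragment H W S \<subseteq> R"
proof -
  obtain Q where Q: "Q \<in> H" "Q \<subseteq> W \<union> S" "fragment H W S = Q - W"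
    "\<And>R'. R' \<in> H \<Longrightarrow> R' \<subseteq> W \<union> S \<Longrightarrow> card (Q - W) \<le> card (R' - W)"
    using fragment_obtains[OF assms(1)] by metis
  have "card (Q - W) \<le> card (R - W)" using Q assms by (intro Q(4)) auto
  moreover have "R - W \<subseteq> Q - W" using assms(3) Q(3) by auto
  moreover have "finite (Q - W)" by (rule finite_subset[of _ S]) (use Q assms in auto)
  ultimately have "R - W = Q - W" by (simp add: card_seteq)
  then show ?thesis using Q(3) by auto
qed

definition recolour :: "('a \<Rightarrow> 'c) \<Rightarrow> 'a set \<Rightarrow> 'c \<Rightarrow> 'a \<Rightarrow> 'c" where
  "recolour \<chi> T c = (\<lambda>u. if u \<in> T then c else \<chi> u)"

definition colour_class :: "'a set \<Rightarrow> ('a \<Rightarrow> 'c) \<Rightarrow> 'c \<Rightarrow> 'a set" where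
  "colour_class U \<chi> c = {u \<in> U. \<chi> u = c}"

text \<open>A pair (colouring, member) is encoded by the colouring in which its fragment \<open>T\<close> has
  been repainted, by \<open>T\<close> itself -- a subset of a set \<open>w\<close> that depends only on the repainted
  colouring --, by the old colours on \<open>T\<close>, and by a member that contains \<open>T\<close>.\<close>

lemma card_fragment_pairs:
  fixes T :: "('a \<Rightarrow> 'c) \<Rightarrow> 'a set \<Rightarrow> 'a set" and w :: "('a \<Rightarrow> 'c) \<Rightarrow> 'a set"
  assumes fin: "finite U" "finite C" and c: "c \<in> C" and P: "P \<subseteq> Pow U"
    and B: "B \<subseteq> (U \<rightarrow>\<^sub>E C) \<times> P"
    and TS: "\<And>\<chi> S. (\<chi>, S) \<in> B \<Longrightarrow> T \<chi> S \<subseteq> S"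
    and Tw: "\<And>\<chi> S. (\<chi>, S) \<in> B \<Longrightarrow> T \<chi> S \<subseteq> w (recolour \<chi> (T \<chi> S) c)"
    and J: "\<And>\<chi> S. (\<chi>, S) \<in> B \<Longrightarrow> J (T \<chi> S)"
    and w: "\<And>\<chi>. w \<chi> \<subseteq> U"
    and D: "\<And>\<chi>. (\<Sum>X | X \<subseteq> w \<chi> \<and> J X. (real (card C) / r) ^ card X) \<le> D"
    and sp: "spread K r P" and r: "r > 0" and K: "K \<ge> 0"
  shows "real (card B) \<le> real (card C) ^ card U * (K * D * real (card P))"
proof -
  let ?\<Omega> = "U \<rightarrow>\<^sub>E C"
  define G where "G = (SIGMA \<chi>:?\<Omega>. SIGMA X:{X. X \<subseteq> w \<chi> \<and> J X}. (X \<rightarrow>\<^sub>E C) \<times> containing P X)"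
  define f where "f = (\<lambda>(\<chi>, S). (recolour \<chi> (T \<chi> S) c, T \<chi> S, restrict \<chi> (T \<chi> S), S))"
  have finP: "finite P" using P fin finite_subset by blast
  have fin\<Omega>: "finite ?\<Omega>" using fin by (intro finite_PiE) auto
  have finw: "finite (w \<chi>)" for \<chi> using w fin finite_subset by blast
  have finX: "finite {X. X \<subseteq> w \<chi> \<and> J X}" for \<chi>
    by (rule finite_subset[of _ "Pow (w \<chi>)"]) (use finw in auto)
  have finc: "finite (containing P X)" for X unfolding containing_def using finP by auto
  have finE: "finite (X \<rightarrow>\<^sub>E C)" if "X \<subseteq> w \<chi>" for X \<chi>
    using that finw fin by (intro finite_PiE) (auto intro: finite_subset)
  \<comment> \<open>Outside \<open>T\<close> the old colouring agrees with the repainted one, and on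
    \<open>T\<close> it is recorded by the restriction.\<close>
  have inj: "inj_on f B"
  proof (rule inj_onI, clarify)
    fix \<chi> S \<chi>' S'
    assume *: "(\<chi>, S) \<in> B" "(\<chi>', S') \<in> B" "f (\<chi>, S) = f (\<chi>', S')"
    then have eq: "S = S'" "T \<chi> S = T \<chi>' S'" "restrict \<chi> (T \<chi> S) = restrict \<chi>' (T \<chi> S)"
      "recolour \<chi> (T \<chi> S) c = recolour \<chi>' (T \<chi> S) c"
      by (auto simp: f_def)
    have "\<chi> u = \<chi>' u" for u
      using fun_cong[OF eq(3), of u] fun_cong[OF eq(4), of u]
      by (cases "u \<in> T \<chi> S") (auto simp: recolour_def)
    then show "\<chi> = \<chi>' \<and> S = S'" using eq by auto
  qed
  have img: "f ` B \<subseteq> G"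
  proof (rule image_subsetI)
    fix p assume "p \<in> B"
    moreover obtain \<chi> S where p: "p = (\<chi>, S)" by (cases p)
    ultimately have b: "(\<chi>, S) \<in> B" by simp
    then have \<chi>: "\<chi> \<in> ?\<Omega>" and S: "S \<in> P" using B by auto
    have TU: "T \<chi> S \<subseteq> U" using TS[OF b] S P by auto
    have "recolour \<chi> (T \<chi> S) c \<in> ?\<Omega>"
      using \<chi> TU c by (auto simp: recolour_def PiE_iff extensional_def)
    moreover have "restrict \<chi> (T \<chi> S) \<in> T \<chi> S \<rightarrow>\<^sub>E C" using \<chi> TU by (auto simp: PiE_iff)
    ultimately show "f p \<in> G" unfolding p
      using Tw[OF b] J[OF b] TS[OF b] S by (auto simp: f_def G_def containing_def)
  qed
  have finG: "finite G" unfolding G_def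
    using fin\<Omega> finX finE finc by (intro finite_SigmaI finite_cartesian_product) auto
  have cG: "card G = (\<Sum>\<chi>\<in>?\<Omega>. \<Sum>X | X \<subseteq> w \<chi> \<and> J X. card C ^ card X * card (containing P X))"
  proof -
    have 1: "card (SIGMA X:{X. X \<subseteq> w \<chi> \<and> J X}. (X \<rightarrow>\<^sub>E C) \<times> containing P X)
        = (\<Sum>X | X \<subseteq> w \<chi> \<and> J X. card C ^ card X * card (containing P X))" for \<chi>
    proof (subst card_SigmaI)
      show "(\<Sum>X | X \<subseteq> w \<chi> \<and> J X. card ((X \<rightarrow>\<^sub>E C) \<times> containing P X))
          = (\<Sum>X | X \<subseteq> w \<chi> \<and> J X. card C ^ card X * card (containing P X))"
        using finw by (intro sum.cong refl)
          (auto simp: card_cartesian_product card_PiE dest: finite_subset)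
    qed (use finX finE finc in auto)
    show ?thesis unfolding G_def
      by (subst card_SigmaI) (use 1 fin\<Omega> finX finE finc in auto)
  qed
  have "real (card B) \<le> real (card G)"
    using card_inj_on_le[OF inj img finG] by simp
  also have "\<dots> = (\<Sum>\<chi>\<in>?\<Omega>. \<Sum>X | X \<subseteq> w \<chi> \<and> J X. real (card C) ^ card X * real (card (containing P X)))"
    by (simp add: cG)
  \<comment> \<open>A candidate \<open>X\<close> allows \<open>card C ^ card X\<close> old
    colourings, while spreadness divides the number of members by \<open>r ^ card X\<close>. This is
    the weight that is summed in \<open>D\<close>.\<close>
  also have "\<dots> \<le> (\<Sum>\<chi>\<in>?\<Omega>. K * D * real (card P))"
  proof (rule sum_mono)
    fix \<chi>
    have "(\<Sum>X | X \<subseteq> w \<chi> \<and> J X. real (card C) ^ card X * real (card (containing P X)))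
        \<le> (\<Sum>X | X \<subseteq> w \<chi> \<and> J X. K * real (card P) * (real (card C) / r) ^ card X)"
    proof (rule sum_mono)
      fix X
      have "real (card (containing P X)) \<le> K * real (card P) / r ^ card X"
        using sp r unfolding spread_def by (simp add: field_simps)
      then have "real (card C) ^ card X * real (card (containing P X))
          \<le> real (card C) ^ card X * (K * real (card P) / r ^ card X)"
        by (intro mult_left_mono) auto
      then show "real (card C) ^ card X * real (card (containing P X))
          \<le> K * real (card P) * (real (card C) / r) ^ card X"
        by (simp add: power_divide field_simps)
    qed
    also have "\<dots> = K * real (card P) * (\<Sum>X | X \<subseteq> w \<chi> \<and> J X. (real (card C) / r) ^ card X)"
      by (simp add: sum_distrib_left)
    also have "\<dots> \<le> K * real (card P) * D" using D K by (intro mult_left_mono) auto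
    finally show "(\<Sum>X | X \<subseteq> w \<chi> \<and> J X. real (card C) ^ card X * real (card (containing P X)))
        \<le> K * D * real (card P)" by (simp add: mult_ac)
  qed
  also have "\<dots> = real (card C) ^ card U * (K * D * real (card P))"
    using fin by (simp add: card_PiE)
  finally show ?thesis .
qed

section \<open>Weighted sums over subsets\<close>

lemma sum_Pow_power_card:
  fixes x :: "'b::comm_semiring_1"
  assumes "finite A"
  shows "(\<Sum>X\<in>Pow A. x ^ card X) = (1 + x) ^ card A"
  using prod_add[OF assms, of "\<lambda>_. x" "\<lambda>_. 1"] by (simp add: add.commute)

text \<open>On the range of summation \<open>2 ^ t\<close> is below \<open>2 ^ card X\<close>.
  Moving this factor into the base makes the sum small enough to be extended to all subsets, where
  the binomial theorem applies.\<close>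

lemma sum_large_subsets_le:
  fixes x :: real
  assumes "finite A" "x \<ge> 0" "card A \<le> n"
  shows "(\<Sum>X | X \<subseteq> A \<and> t < card X. x ^ card X) \<le> (1 / 2) ^ t * (1 + 2 * x) ^ n"
proof -
  have "(\<Sum>X | X \<subseteq> A \<and> t < card X. x ^ card X)
      \<le> (\<Sum>X | X \<subseteq> A \<and> t < card X. (1 / 2) ^ t * (2 * x) ^ card X)"
  proof (rule sum_mono)
    fix X assume "X \<in> {X. X \<subseteq> A \<and> t < card X}"
    then have "(2::real) ^ t \<le> 2 ^ card X" by (intro power_increasing) auto
    then have "x ^ card X * 2 ^ t \<le> x ^ card X * 2 ^ card X"
      using assms by (intro mult_left_mono) auto
    then show "x ^ card X \<le> (1 / 2) ^ t * (2 * x) ^ card X"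
      by (simp add: power_mult_distrib power_divide field_simps)
  qed
  also have "\<dots> \<le> (\<Sum>X\<in>Pow A. (1 / 2) ^ t * (2 * x) ^ card X)"
    using assms by (intro sum_mono2) auto
  also have "\<dots> = (1 / 2) ^ t * (1 + 2 * x) ^ card A"
    using sum_Pow_power_card[OF assms(1), of "2 * x"] by (simp flip: sum_distrib_left)
  also have "\<dots> \<le> (1 / 2) ^ t * (1 + 2 * x) ^ n"
    using assms by (intro mult_left_mono power_increasing) auto
  finally show ?thesis .
qed

lemma sum_nonempty_subsets_le:
  fixes x :: real
  assumes "finite A" "x \<ge> 0" "card A \<le> n"
  shows "(\<Sum>X | X \<subseteq> A \<and> X \<noteq> {}. x ^ card X) \<le> (1 + x) ^ n - 1"
proof -
  have "{X. X \<subseteq> A \<and> X \<noteq> {}} = Pow A - {{}}" by auto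
  then have "(\<Sum>X | X \<subseteq> A \<and> X \<noteq> {}. x ^ card X) = (1 + x) ^ card A - 1"
    using sum_Pow_power_card[OF assms(1), of x] assms(1) by (simp add: sum_diff1)
  also have "(1 + x) ^ card A \<le> (1 + x) ^ n"
    using assms by (intro power_increasing) auto
  finally show ?thesis by simp
qed

lemma colour_class_recolour:
  assumes "T \<subseteq> U"
  shows "colour_class U (recolour \<chi> T c) c = colour_class U \<chi> c \<union> T"
    and "c \<noteq> d \<Longrightarrow> T \<inter> colour_class U \<chi> d = {} \<Longrightarrow>
      colour_class U (recolour \<chi> T c) d = colour_class U \<chi> d"
  using assms by (auto simp: colour_class_def recolour_def)

text \<open>The choice depends on \<open>Z\<close> alone, so a decoder who knows only the repainted
  colouring makes the same choice. The default \<open>{}\<close> keeps the chosen set inside the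
  ground set and within the size bound.\<close>

definition member_below :: "'a set set \<Rightarrow> 'a set \<Rightarrow> 'a set" where
  "member_below H Z = (if \<exists>R\<in>H. R \<subseteq> Z then SOME R. R \<in> H \<and> R \<subseteq> Z else {})"

lemma member_belowD:
  assumes "R \<in> H" "R \<subseteq> Z"
  shows "member_below H Z \<in> H \<and> member_below H Z \<subseteq> Z"
proof -
  have "\<exists>R. R \<in> H \<and> R \<subseteq> Z" using assms by blast
  from someI_ex[OF this] show ?thesis using assms by (auto simp: member_below_def)
qed

lemma member_below_cases: "member_below H Z = {} \<or> member_below H Z \<in> H"
  using member_belowD[of _ H Z] by (cases "\<exists>R\<in>H. R \<subseteq> Z") (blast, simp add: member_below_def)

text \<open>The union of \<open>W\<close> and the fragment is exactly the colour class after
  repainting. So the fragment is found among the subsets of one small set that this class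
  determines.\<close>

lemma fragment_subset_member_below:
  assumes "S \<in> H" "finite S"
  shows "fragment H W S \<subseteq> member_below H (W \<union> fragment H W S)"
proof -
  obtain R where "R \<in> H" "R \<subseteq> W \<union> fragment H W S"
    using ex_subset_Un_fragment[OF assms(1)] by blast
  from member_belowD[OF this] show ?thesis
    using fragment_subset_witness[OF assms(1)] assms(2) by blast
qed

text \<open>Two rounds of fragmentation: the colour \<open>c0\<close> leaves fragments of size at most \<open>t\<close>, which is
  much smaller than \<open>r\<close>, and then the colour \<open>c1\<close> typically covers one of them entirely.\<close>

lemma few_uncovering_colourings:
  fixes C :: "'c set"
  assumes fin: "finite U" and C: "card C = 4" "c0 \<in> C" "c1 \<in> C" "c0 \<noteq> c1"
    and P: "P \<subseteq> Pow U" "P \<noteq> {}" "\<And>S. S \<in> P \<Longrightarrow> card S \<le> n"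
    and sp: "spread K r P" and r: "r > 0" and K: "K \<ge> 0"
    and small: "K * ((1 / 2) ^ t * (1 + 8 / r) ^ n + ((1 + 4 / r) ^ t - 1)) < 1 / 2"
  shows "2 * card {\<chi> \<in> U \<rightarrow>\<^sub>E C. \<forall>S\<in>P. \<not> S \<subseteq> colour_class U \<chi> c0 \<union> colour_class U \<chi> c1} < 4 ^ card U"
proof -
  let ?\<Omega> = "U \<rightarrow>\<^sub>E C"
  define W where "W c \<chi> = colour_class U \<chi> c" for c :: 'c and \<chi>
  define f1 where "f1 \<chi> S = fragment P (W c0 \<chi>) S" for \<chi> S
  \<comment> \<open>The second round is played with the short fragments as its family. Their size
    \<open>t\<close> takes the place of \<open>n\<close>, which makes the count of all nonempty
    second fragments affordable.\<close>
  define H where "H Z = {fragment P Z S | S. S \<in> P \<and> card (fragment P Z S) \<le> t}" for Z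
  define f2 where "f2 \<chi> S = fragment (H (W c0 \<chi>)) (W c1 \<chi>) (f1 \<chi> S)" for \<chi> S
  define B1 where "B1 = {(\<chi>, S) \<in> ?\<Omega> \<times> P. t < card (f1 \<chi> S)}"
  define B2 where "B2 = {(\<chi>, S) \<in> ?\<Omega> \<times> P. card (f1 \<chi> S) \<le> t \<and> f2 \<chi> S \<noteq> {}}"
  define Bad where "Bad = {\<chi> \<in> ?\<Omega>. \<forall>S\<in>P. \<not> S \<subseteq> W c0 \<chi> \<union> W c1 \<chi>}"
  \<comment> \<open>The weight in both sums is \<open>4 / r\<close>, with 4 the number of colours;
    the first sum doubles it to 8.\<close>
  define D1 where "D1 = (1 / 2) ^ t * (1 + 8 / r) ^ n"
  define D2 where "D2 = (1 + 4 / r) ^ t - 1"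
  have finC: "finite C" by (rule card_ge_0_finite) (simp add: C(1))
  have finP: "finite P" using P fin finite_subset by blast
  have fin\<Omega>: "finite ?\<Omega>" using fin finC by (intro finite_PiE) auto
  have finS: "finite S" if "S \<in> P" for S using that P fin by (meson PowD finite_subset subsetD)
  have SU: "S \<subseteq> U" if "S \<in> P" for S using that P by auto
  have f1: "f1 \<chi> S \<subseteq> S - W c0 \<chi>" if "S \<in> P" for \<chi> S
    unfolding f1_def using fragment_subset[OF that] .
  have HU: "R \<subseteq> U" "card R \<le> t" "finite R" if RH: "R \<in> H Z" for R Z
  proof -
    obtain S where S: "S \<in> P" "R = fragment P Z S" "card (fragment P Z S) \<le> t"
      using RH by (auto simp: H_def)
    then show "R \<subseteq> U" using fragment_subset[OF S(1), of Z] SU[OF S(1)] by blast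
    then show "finite R" using fin finite_subset by blast
    show "card R \<le> t" using S by simp
  qed
  have f1H: "f1 \<chi> S \<in> H (W c0 \<chi>)" if "S \<in> P" "card (f1 \<chi> S) \<le> t" for \<chi> S
    using that by (auto simp: H_def f1_def)
  have f2: "f2 \<chi> S \<subseteq> f1 \<chi> S - W c1 \<chi>" if "S \<in> P" "card (f1 \<chi> S) \<le> t" for \<chi> S
    unfolding f2_def using fragment_subset[OF f1H[OF that]] .
  have mP: "member_below P Z \<subseteq> U" "card (member_below P Z) \<le> n" for Z
    using member_below_cases[of P Z] SU[of "member_below P Z"] P(3)[of "member_below P Z"] by auto
  have mH: "member_below (H Y) Z \<subseteq> U" "card (member_below (H Y) Z) \<le> t" for Y Z
    using member_below_cases[of "H Y" Z] HU(1,2)[of "member_below (H Y) Z" Y] by auto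
  have finm: "finite (member_below P Z)" "finite (member_below (H Y) Z)" for Y Z
    by (rule finite_subset[OF mP(1) fin], rule finite_subset[OF mH(1) fin])
  have "real (card B1) \<le> real (card C) ^ card U * (K * D1 * real (card P))"
  proof (rule card_fragment_pairs[where T = f1 and w = "\<lambda>\<chi>. member_below P (W c0 \<chi>)"
        and J = "\<lambda>X. t < card X" and c = c0, OF fin finC C(2) P(1) _ _ _ _ _ _ sp r K])
    fix \<chi> S assume "(\<chi>, S) \<in> B1"
    then have S: "S \<in> P" by (simp add: B1_def)
    show "f1 \<chi> S \<subseteq> S" using f1[OF S] by auto
    have "W c0 (recolour \<chi> (f1 \<chi> S) c0) = W c0 \<chi> \<union> f1 \<chi> S"
      unfolding W_def using f1[OF S] SU[OF S] by (intro colour_class_recolour) auto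
    then show "f1 \<chi> S \<subseteq> member_below P (W c0 (recolour \<chi> (f1 \<chi> S) c0))"
      using fragment_subset_member_below[OF S finS[OF S]] by (simp add: f1_def)
  next
    fix \<chi>
    show "member_below P (W c0 \<chi>) \<subseteq> U" by (rule mP)
    show "(\<Sum>X | X \<subseteq> member_below P (W c0 \<chi>) \<and> t < card X. (real (card C) / r) ^ card X) \<le> D1"
      using sum_large_subsets_le[of "member_below P (W c0 \<chi>)" "4 / r" n t] mP finm r
      by (simp add: C D1_def)
  qed (auto simp: B1_def)
  moreover have "real (card B2) \<le> real (card C) ^ card U * (K * D2 * real (card P))"
  proof (rule card_fragment_pairs[where T = f2 and w = "\<lambda>\<chi>. member_below (H (W c0 \<chi>)) (W c1 \<chi>)"
        and J = "\<lambda>X. X \<noteq> {}" and c = c1, OF fin finC C(3) P(1) _ _ _ _ _ _ sp r K])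
    fix \<chi> S assume "(\<chi>, S) \<in> B2"
    then have S: "S \<in> P" and t: "card (f1 \<chi> S) \<le> t" by (auto simp: B2_def)
    note 2 = f2[OF S t] f1[OF S, of \<chi>] SU[OF S]
    show "f2 \<chi> S \<subseteq> S" using 2 by auto
    have "W c1 (recolour \<chi> (f2 \<chi> S) c1) = W c1 \<chi> \<union> f2 \<chi> S"
      unfolding W_def using 2 by (intro colour_class_recolour) auto
    \<comment> \<open>Second fragments contain no point of colour \<open>c0\<close>, so repainting
      them with \<open>c1\<close> preserves the family on which the second round depends, as
      decoding requires.\<close>
    moreover have "W c0 (recolour \<chi> (f2 \<chi> S) c1) = W c0 \<chi>"
      unfolding W_def using 2 C(4) by (intro colour_class_recolour) (auto simp: W_def)
    ultimately show "f2 \<chi> S \<subseteq> member_below (H (W c0 (recolour \<chi> (f2 \<chi> S) c1)))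
        (W c1 (recolour \<chi> (f2 \<chi> S) c1))"
      using fragment_subset_member_below[OF f1H[OF S t]] HU(3)[OF f1H[OF S t]] by (simp add: f2_def)
  next
    fix \<chi>
    show "member_below (H (W c0 \<chi>)) (W c1 \<chi>) \<subseteq> U" by (rule mH)
    show "(\<Sum>X | X \<subseteq> member_below (H (W c0 \<chi>)) (W c1 \<chi>) \<and> X \<noteq> {}. (real (card C) / r) ^ card X) \<le> D2"
      using sum_nonempty_subsets_le[of "member_below (H (W c0 \<chi>)) (W c1 \<chi>)" "4 / r" t] mH finm r
      by (simp add: C D2_def)
  qed (auto simp: B2_def)
  moreover have "card Bad * card P \<le> card B1 + card B2"
  proof -
    \<comment> \<open>If \<open>S\<close> had a short first fragment and an empty second one, some
      short fragment would lie in colour \<open>c1\<close>; together with colour \<open>c0\<close>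
      it covers a member of \<open>P\<close>, so the colouring is not bad.\<close>
    have "Bad \<times> P \<subseteq> B1 \<union> B2"
    proof clarify
      fix \<chi> S assume \<chi>: "\<chi> \<in> Bad" and S: "S \<in> P" and n2: "(\<chi>, S) \<notin> B2"
      show "(\<chi>, S) \<in> B1"
      proof (rule ccontr)
        assume "(\<chi>, S) \<notin> B1"
        then have t: "card (f1 \<chi> S) \<le> t" and e: "f2 \<chi> S = {}"
          using \<chi> S n2 by (auto simp: B1_def B2_def Bad_def)
        obtain R where R: "R \<in> H (W c0 \<chi>)" "R \<subseteq> W c1 \<chi>"
          using fragment_empty_imp[OF f1H[OF S t]] e unfolding f2_def by blast
        then obtain S' where S': "S' \<in> P" "R = fragment P (W c0 \<chi>) S'" by (auto simp: H_def)
        then obtain R' where "R' \<in> P" "R' \<subseteq> W c0 \<chi> \<union> R"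
          using ex_subset_Un_fragment by metis
        then show False using R \<chi> unfolding Bad_def by blast
      qed
    qed
    moreover have "finite (B1 \<union> B2)"
      by (rule finite_subset[of _ "?\<Omega> \<times> P"]) (use fin\<Omega> finP in \<open>auto simp: B1_def B2_def\<close>)
    ultimately have "card (Bad \<times> P) \<le> card (B1 \<union> B2)" by (intro card_mono) auto
    then show ?thesis using card_Un_le[of B1 B2] by (simp add: card_cartesian_product)
  qed
  then have "real (card Bad) * real (card P) \<le> real (card B1) + real (card B2)"
    by (metis of_nat_add of_nat_le_iff of_nat_mult)
  ultimately have "real (card Bad) * real (card P)
      \<le> 4 ^ card U * (K * D1 * real (card P)) + 4 ^ card U * (K * D2 * real (card P))"
    by (simp add: C)
  also have "\<dots> = (4 ^ card U * (K * (D1 + D2))) * real (card P)" by (simp add: algebra_simps)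
  finally have "real (card Bad) \<le> 4 ^ card U * (K * (D1 + D2))"
    using P finP by (simp add: card_gt_0_iff)
  also have "\<dots> < 4 ^ card U * (1 / 2)"
    using small by (intro mult_strict_left_mono) (auto simp: D1_def D2_def)
  finally have "real (2 * card Bad) < real (4 ^ card U)" by simp
  then show ?thesis unfolding Bad_def W_def of_nat_less_iff .
qed

lemma spread_imp_disjoint_members:
  assumes fin: "finite U" and P: "P \<subseteq> Pow U" "P \<noteq> {}" and Q: "Q \<subseteq> Pow U" "Q \<noteq> {}"
    and n: "\<And>S. S \<in> P \<union> Q \<Longrightarrow> card S \<le> n"
    and sp: "spread K r P" "spread K r Q" and r: "r > 0" and K: "K \<ge> 0"
    and small: "K * ((1 / 2) ^ t * (1 + 8 / r) ^ n + ((1 + 4 / r) ^ t - 1)) < 1 / 2"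
  shows "\<exists>S\<in>P. \<exists>T\<in>Q. S \<inter> T = {}"
proof -
  \<comment> \<open>Each half of the ground set is split into two colours, one per round: 0 and 1
    serve \<open>P\<close>, 2 and 3 serve \<open>Q\<close>.\<close>
  define C where "C = {0::nat, 1, 2, 3}"
  define bad where "bad P c d = {\<chi> \<in> U \<rightarrow>\<^sub>E C. \<forall>S\<in>P. \<not> S \<subseteq> colour_class U \<chi> c \<union> colour_class U \<chi> d}"
    for P c d
  have "2 * card (bad P 0 1) < 4 ^ card U" unfolding bad_def
    by (rule few_uncovering_colourings[OF fin _ _ _ _ P n sp(1) r K small]) (auto simp: C_def)
  moreover have "2 * card (bad Q 2 3) < 4 ^ card U" unfolding bad_def
    by (rule few_uncovering_colourings[OF fin _ _ _ _ Q n sp(2) r K small]) (auto simp: C_def)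
  ultimately have "card (bad P 0 1 \<union> bad Q 2 3) < 4 ^ card U"
    using card_Un_le[of "bad P 0 1" "bad Q 2 3"] by linarith
  also have "\<dots> = card (U \<rightarrow>\<^sub>E C)" using fin by (simp add: card_PiE C_def numeral_eq_Suc)
  finally have *: "card (bad P 0 1 \<union> bad Q 2 3) < card (U \<rightarrow>\<^sub>E C)" .
  have "finite (U \<rightarrow>\<^sub>E C)" using fin by (intro finite_PiE) (auto simp: C_def)
  then have "finite (bad P 0 1 \<union> bad Q 2 3)" by (simp add: bad_def)
  with * have "\<not> (U \<rightarrow>\<^sub>E C) \<subseteq> bad P 0 1 \<union> bad Q 2 3" using card_mono leD by blast
  then obtain \<chi> :: "'a \<Rightarrow> nat" and S T where "S \<in> P" "S \<subseteq> colour_class U \<chi> 0 \<union> colour_class U \<chi> 1"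
    "T \<in> Q" "T \<subseteq> colour_class U \<chi> 2 \<union> colour_class U \<chi> 3"
    unfolding bad_def by blast
  moreover have "(colour_class U \<chi> 0 \<union> colour_class U \<chi> 1)
      \<inter> (colour_class U \<chi> 2 \<union> colour_class U \<chi> 3) = {}"
    by (auto simp: colour_class_def)
  ultimately show ?thesis by blast
qed

section \<open>Intersecting subfamilies of spread families\<close>

text \<open>Take a largest \<open>X\<close> whose members make up at least the fraction
  \<open>r ^ (- card X)\<close> of \<open>F\<close>. By maximality no further set \<open>Z\<close>
  is dense among these members, so they are spread around \<open>X\<close>; they are removed and the
  argument is repeated. It stops when \<open>F\<close> is empty or when \<open>X\<close> has at
  least \<open>q\<close> points. In the latter case the spreadness of the ambient family bounds all
  that is left, so the error is paid only once.\<close>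

lemma spread_decomposition:
  fixes r s :: real
  assumes U: "finite U" and A: "A \<subseteq> Pow U" and s: "spread 1 s A"
    and r: "1 \<le> r" "r \<le> s" and F: "F \<subseteq> A"
  shows "\<exists>\<X> F'. F' \<subseteq> F \<and> real (card F') \<le> (r / s) ^ q * real (card A) \<and>
    (\<forall>S\<in>F - F'. \<exists>X\<in>\<X>. X \<subseteq> S) \<and>
    (\<forall>X\<in>\<X>. X \<subseteq> U \<and> card X < q \<and> (\<exists>P. P \<subseteq> F \<and> P \<noteq> {} \<and> (\<forall>S\<in>P. X \<subseteq> S) \<and>
      (\<forall>Z. Z \<inter> X = {} \<longrightarrow> r ^ card Z * real (card (containing P Z)) \<le> real (card P))))"
proof -
  have "finite F" using U A F by (meson finite_Pow_iff finite_subset)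
  then show ?thesis using F
  proof (induction F rule: finite_psubset_induct)
    case (psubset F)
    show ?case
    proof (cases "F = {}")
      case True
      then show ?thesis using r by (intro exI[of _ "{}"]) auto
    next
      case False
      define Xs where "Xs = {X \<in> Pow U. real (card F) \<le> r ^ card X * real (card (containing F X))}"
      have finXs: "finite Xs" using U by (simp add: Xs_def)
      have "{} \<in> Xs" by (simp add: Xs_def containing_def)
      then have "Max (card ` Xs) \<in> card ` Xs" using finXs by (intro Max_in) auto
      then obtain X where X: "X \<in> Xs" "card X = Max (card ` Xs)" by auto
      have max: "card Y \<le> card X" if "Y \<in> Xs" for Y using that finXs X(2) by simp
      have XF: "real (card F) \<le> r ^ card X * real (card (containing F X))" "X \<subseteq> U"
        using X(1) by (auto simp: Xs_def)
      have finX: "finite X" using XF U finite_subset by blast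
      show ?thesis
      proof (cases "card X < q")
        case False
        have "containing F X \<subseteq> containing A X" using psubset.prems by (auto simp: containing_def)
        moreover have "finite (containing A X)"
          using A U by (auto simp: containing_def intro: finite_subset[of _ "Pow U"])
        ultimately have "real (card (containing F X)) \<le> real (card (containing A X))"
          by (simp add: card_mono)
        also have "\<dots> \<le> real (card A) / s ^ card X"
          using s r by (simp add: spread_def field_simps)
        finally have "r ^ card X * real (card (containing F X)) \<le> r ^ card X * (real (card A) / s ^ card X)"
          using r by (intro mult_left_mono) auto
        also have "\<dots> = (r / s) ^ card X * real (card A)" by (simp add: power_divide)
        also have "\<dots> \<le> (r / s) ^ q * real (card A)"
          using r False by (intro mult_right_mono power_decreasing) auto
        finally show ?thesis using XF by (intro exI[of _ "{}"] exI[of _ F]) auto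
      next
        case True
        define P where "P = containing F X"
        have PF: "P \<subseteq> F" "\<forall>S\<in>P. X \<subseteq> S" by (auto simp: P_def containing_def)
        have "real (card F) > 0" using False psubset.hyps by (simp add: card_gt_0_iff)
        then have P0: "P \<noteq> {}" using XF by (auto simp: P_def)
        have sp: "r ^ card Z * real (card (containing P Z)) \<le> real (card P)" if Z: "Z \<inter> X = {}" for Z
        proof -
          consider "Z = {}" | "\<not> Z \<subseteq> U" | "Z \<noteq> {}" "Z \<subseteq> U" by blast
          then show ?thesis
          proof cases
            case 1
            then show ?thesis by (simp add: containing_def)
          next
            case 2
              moreover have "P \<subseteq> Pow U" using PF psubset.prems A by blast
            ultimately have "containing P Z = {}" unfolding containing_def by blast
            then show ?thesis by simp
          next
            case 3
            then have finZ: "finite Z" using U finite_subset by blast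
            have c: "card (X \<union> Z) = card X + card Z"
              using finX finZ Z by (intro card_Un_disjoint) auto
            have "card Z > 0" using 3 finZ by (simp add: card_gt_0_iff)
            then have "X \<union> Z \<notin> Xs" using max[of "X \<union> Z"] c by auto
            then have "r ^ card (X \<union> Z) * real (card (containing F (X \<union> Z))) \<le> real (card F)"
              using 3 XF by (auto simp: Xs_def)
            moreover have "containing F (X \<union> Z) = containing P Z" by (auto simp: P_def containing_def)
            ultimately have "r ^ card X * (r ^ card Z * real (card (containing P Z)))
                \<le> r ^ card X * real (card P)"
              using XF c by (simp add: P_def power_add mult.assoc)
            then show ?thesis using r by simp
          qed
        qed
        have "F - P \<subset> F" "F - P \<subseteq> A" using P0 PF psubset.prems by blast+
        from psubset.IH[OF this] obtain \<X> F' where IH: "F' \<subseteq> F - P" "real (card F') \<le> (r / s) ^ q * real (card A)"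
          "\<forall>S\<in>F - P - F'. \<exists>X\<in>\<X>. X \<subseteq> S"
          "\<forall>X\<in>\<X>. X \<subseteq> U \<and> card X < q \<and> (\<exists>Q. Q \<subseteq> F - P \<and> Q \<noteq> {} \<and> (\<forall>S\<in>Q. X \<subseteq> S) \<and>
            (\<forall>Z. Z \<inter> X = {} \<longrightarrow> r ^ card Z * real (card (containing Q Z)) \<le> real (card Q)))"
          by (elim exE conjE) (rule that)
        show ?thesis
        proof (rule exI[of _ "insert X \<X>"], rule exI[of _ F'], intro conjI)
          show "\<forall>S\<in>F - F'. \<exists>X\<in>insert X \<X>. X \<subseteq> S"
          proof
            fix S assume "S \<in> F - F'"
            then show "\<exists>X\<in>insert X \<X>. X \<subseteq> S" using IH(3) PF(2) by (cases "S \<in> P") auto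
          qed
          show "\<forall>Y\<in>insert X \<X>. Y \<subseteq> U \<and> card Y < q \<and> (\<exists>P. P \<subseteq> F \<and> P \<noteq> {} \<and> (\<forall>S\<in>P. Y \<subseteq> S) \<and>
            (\<forall>Z. Z \<inter> Y = {} \<longrightarrow> r ^ card Z * real (card (containing P Z)) \<le> real (card P)))"
          proof
            fix Y assume "Y \<in> insert X \<X>"
            then show "Y \<subseteq> U \<and> card Y < q \<and> (\<exists>P. P \<subseteq> F \<and> P \<noteq> {} \<and> (\<forall>S\<in>P. Y \<subseteq> S) \<and>
              (\<forall>Z. Z \<inter> Y = {} \<longrightarrow> r ^ card Z * real (card (containing P Z)) \<le> real (card P)))"
            proof
              assume "Y = X"
              then show ?thesis using XF True PF P0 sp by blast
            next
              assume "Y \<in> \<X>"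
              from bspec[OF IH(4) this] obtain Q where "Y \<subseteq> U \<and> card Y < q" "Q \<subseteq> F - P" "Q \<noteq> {} \<and> (\<forall>S\<in>Q. Y \<subseteq> S) \<and>
                (\<forall>Z. Z \<inter> Y = {} \<longrightarrow> r ^ card Z * real (card (containing Q Z)) \<le> real (card Q))" by blast
              then show ?thesis by blast
            qed
          qed
        qed (use IH in auto)
      qed
    qed
  qed
qed

text \<open>Each point of \<open>Y\<close> lies in at most a fraction \<open>1 / r\<close> of the
  members, so discarding those that meet \<open>Y\<close> keeps at least half. Removing
  \<open>X\<close> afterwards merges nothing, because all members contain \<open>X\<close>.\<close>

lemma spread_link:
  fixes r :: real
  assumes U: "finite U" and P: "P \<subseteq> Pow U" "P \<noteq> {}" and X: "\<And>S. S \<in> P \<Longrightarrow> X \<subseteq> S"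
    and sp: "\<And>Z. Z \<inter> X = {} \<Longrightarrow> r ^ card Z * real (card (containing P Z)) \<le> real (card P)"
    and Y: "finite Y" "X \<inter> Y = {}" "2 * real (card Y) \<le> r" and r: "r > 0"
  defines "L \<equiv> (\<lambda>S. S - X) ` {S \<in> P. S \<inter> Y = {}}"
  shows "L \<noteq> {}" and "spread 2 r L"
proof -
  have finP: "finite P" using P U by (meson finite_Pow_iff finite_subset)
  have finS: "finite S" if "S \<in> P" for S using that P U by (meson PowD finite_subset subsetD)
  have finc: "finite (containing P Z)" for Z using finP by (simp add: containing_def)
  define P0 where "P0 = {S \<in> P. S \<inter> Y = {}}"
  have finP0: "finite P0" using finP by (simp add: P0_def)
  have "P \<subseteq> P0 \<union> (\<Union>y\<in>Y. containing P {y})" by (auto simp: P0_def containing_def)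
  then have "card P \<le> card (P0 \<union> (\<Union>y\<in>Y. containing P {y}))"
    using finP0 finc Y by (intro card_mono) auto
  also have "\<dots> \<le> card P0 + (\<Sum>y\<in>Y. card (containing P {y}))"
    by (rule order_trans[OF card_Un_le add_left_mono[OF card_UN_le[OF Y(1)]]])
  finally have "real (card P) \<le> real (card P0 + (\<Sum>y\<in>Y. card (containing P {y})))"
    by (simp only: of_nat_le_iff)
  also have "\<dots> = real (card P0) + (\<Sum>y\<in>Y. real (card (containing P {y})))" by simp
  also have "(\<Sum>y\<in>Y. real (card (containing P {y}))) \<le> (\<Sum>y\<in>Y. real (card P) / r)"
  proof (rule sum_mono)
    fix y assume "y \<in> Y"
    then have "r ^ card {y} * real (card (containing P {y})) \<le> real (card P)"
      using Y by (intro sp) auto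
    then show "real (card (containing P {y})) \<le> real (card P) / r"
      using r by (simp add: field_simps)
  qed
  also have "\<dots> = (2 * real (card Y)) * real (card P) / (2 * r)" by simp
  also have "\<dots> \<le> r * real (card P) / (2 * r)"
    using Y r by (intro divide_right_mono mult_right_mono) auto
  also have "\<dots> = real (card P) / 2" using r by simp
  finally have half: "real (card P) \<le> 2 * real (card P0)" by simp
  have inj: "inj_on (\<lambda>S. S - X) P0"
  proof (rule inj_onI)
    fix S T assume "S \<in> P0" "T \<in> P0" "S - X = T - X"
    then show "S = T" using X[of S] X[of T] by (auto simp: P0_def)
  qed
  have L: "L = (\<lambda>S. S - X) ` P0" by (simp add: L_def P0_def)
  have cL: "card L = card P0" unfolding L using inj by (rule card_image)
  have "real (card P) > 0" using P finP by (simp add: card_gt_0_iff)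
  then show "L \<noteq> {}" using half cL by auto
  show "spread 2 r L" unfolding spread_def
  proof
    fix Z
    show "r ^ card Z * real (card (containing L Z)) \<le> 2 * real (card L)"
    proof (cases "Z \<inter> X = {}")
      case True
      have "containing L Z \<subseteq> (\<lambda>S. S - X) ` containing P Z"
        by (auto simp: L P0_def containing_def)
      then have "card (containing L Z) \<le> card (containing P Z)"
        using finc by (meson card_image_le card_mono finite_imageI order_trans)
      then have "r ^ card Z * real (card (containing L Z)) \<le> r ^ card Z * real (card (containing P Z))"
        using r by (intro mult_left_mono) auto
      also have "\<dots> \<le> real (card P)" by (rule sp[OF True])
      finally show ?thesis using half cL by simp
    next
      case False
      then have "containing L Z = {}" by (auto simp: L containing_def)
      then show ?thesis by simp
    qed
  qed
qed

lemma intersecting_subfamily_of_spread: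
  fixes r s :: real
  assumes U: "finite U" and A: "A \<subseteq> Pow U" "\<And>S. S \<in> A \<Longrightarrow> card S \<le> n" and s: "spread 1 s A"
    and r: "1 \<le> r" "r \<le> s" "2 * real q \<le> r"
    and small: "2 * ((1 / 2) ^ t * (1 + 8 / r) ^ n + ((1 + 4 / r) ^ t - 1)) < 1 / 2"
    and F: "F \<subseteq> A" and int: "\<And>S T. S \<in> F \<Longrightarrow> T \<in> F \<Longrightarrow> S \<inter> T \<noteq> {}"
  shows "(\<exists>x. real (card {S \<in> F. x \<notin> S}) \<le> (r / s) ^ q * real (card A)) \<or>
    real (card F) \<le> ((real q / s)\<^sup>2 + (r / s) ^ q) * real (card A)"
proof -
  have finA: "finite A" using U A by (meson finite_Pow_iff finite_subset)
  then have finF: "finite F" using F finite_subset by blast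
  obtain \<X> F' where F': "F' \<subseteq> F" "real (card F') \<le> (r / s) ^ q * real (card A)"
    and cover: "\<forall>S\<in>F - F'. \<exists>X\<in>\<X>. X \<subseteq> S"
    and \<X>: "\<forall>X\<in>\<X>. X \<subseteq> U \<and> card X < q \<and> (\<exists>P. P \<subseteq> F \<and> P \<noteq> {} \<and> (\<forall>S\<in>P. X \<subseteq> S) \<and>
      (\<forall>Z. Z \<inter> X = {} \<longrightarrow> r ^ card Z * real (card (containing P Z)) \<le> real (card P)))"
    using spread_decomposition[OF U A(1) s r(1,2) F, of q] by (elim exE conjE) (rule that)
  have finX: "finite X" "card X < q" if "X \<in> \<X>" for X
    using that \<X> finite_subset[OF _ U, of X] by auto
  \<comment> \<open>Suppose the centres are disjoint. Members of each piece that avoid the other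
    centre, with their own centre removed, still form spread families with \<open>K = 2\<close>.
    Disjoint sets from these two families extend to disjoint members of \<open>F\<close>, since
    neither member touches the other centre.\<close>
  have meet: "X \<inter> Y \<noteq> {}" if XY: "X \<in> \<X>" "Y \<in> \<X>" for X Y
  proof
    assume dis: "X \<inter> Y = {}"
    obtain P where P: "P \<subseteq> F" "P \<noteq> {}" "\<And>S. S \<in> P \<Longrightarrow> X \<subseteq> S"
      "\<And>Z. Z \<inter> X = {} \<Longrightarrow> r ^ card Z * real (card (containing P Z)) \<le> real (card P)"
      using bspec[OF \<X> XY(1)] by blast
    obtain Q where Q: "Q \<subseteq> F" "Q \<noteq> {}" "\<And>S. S \<in> Q \<Longrightarrow> Y \<subseteq> S"
      "\<And>Z. Z \<inter> Y = {} \<Longrightarrow> r ^ card Z * real (card (containing Q Z)) \<le> real (card Q)"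
      using bspec[OF \<X> XY(2)] by blast
    define P' where "P' = (\<lambda>S. S - X) ` {S \<in> P. S \<inter> Y = {}}"
    define Q' where "Q' = (\<lambda>S. S - Y) ` {S \<in> Q. S \<inter> X = {}}"
    have PQU: "P \<subseteq> Pow U" "Q \<subseteq> Pow U" using P Q F A by auto
    have P': "P' \<noteq> {}" "spread 2 r P'" unfolding P'_def
      by (rule spread_link[where Y = Y, OF U PQU(1) P(2-4)]; use finX[OF XY(2)] dis r in auto)+
    have Q': "Q' \<noteq> {}" "spread 2 r Q'" unfolding Q'_def
      by (rule spread_link[where Y = X, OF U PQU(2) Q(2-4)]; use finX[OF XY(1)] dis r in auto)+
    have PQU': "P' \<subseteq> Pow U" "Q' \<subseteq> Pow U" using PQU by (auto simp: P'_def Q'_def)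
    have size: "card S \<le> n" if "S \<in> P' \<union> Q'" for S
    proof -
      have *: "card (R - X) \<le> n" if "R \<in> F" for R X
        using that F A U by (meson PowD card_mono Diff_subset finite_subset order_trans subsetD)
      show ?thesis using that P(1) Q(1) by (auto simp: P'_def Q'_def intro!: *)
    qed
    have "\<exists>S\<in>P'. \<exists>T\<in>Q'. S \<inter> T = {}"
      using small r
      by (intro spread_imp_disjoint_members[OF U PQU'(1) P'(1) PQU'(2) Q'(1) size P'(2) Q'(2)]) auto
    then obtain S T where "S \<in> P" "S \<inter> Y = {}" "T \<in> Q" "T \<inter> X = {}" "(S - X) \<inter> (T - Y) = {}"
      unfolding P'_def Q'_def by blast
    then have "S \<inter> T = {}" "S \<in> F" "T \<in> F" using P Q by auto
    then show False using int by blast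
  qed
  consider "\<X> = {}" | x where "\<forall>X\<in>\<X>. x \<in> X" | X0 where "X0 \<in> \<X>" "\<forall>x. \<exists>X\<in>\<X>. x \<notin> X"
    by blast
  then show ?thesis
  proof cases
    case 1
    then have "F' = F" using F' cover by auto
    then show ?thesis using F'(2) by (auto simp: distrib_right intro: add_increasing)
  next
    case 2
    then have "{S \<in> F. x \<notin> S} \<subseteq> F'" using cover by blast
    then have "real (card {S \<in> F. x \<notin> S}) \<le> real (card F')"
      using F' finF by (simp add: card_mono finite_subset)
    from order_trans[OF this F'(2)] show ?thesis by blast
  next
    case 3
    \<comment> \<open>\<open>Y x\<close> is a centre that misses \<open>x\<close>. Every centre
      meets \<open>X0\<close> in some \<open>x\<close> and \<open>Y x\<close> in some
      \<open>y\<close>, and \<open>x\<close> and \<open>y\<close> differ; so it contains one of at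
      most \<open>q^2\<close> genuine pairs.\<close>
    then obtain Y where Y: "\<And>x. Y x \<in> \<X>" "\<And>x. x \<notin> Y x" by metis
    define pairs where "pairs = (SIGMA x:X0. Y x)"
    have fin: "finite pairs" unfolding pairs_def using finX 3 Y by (intro finite_SigmaI) auto
    have "card pairs = (\<Sum>x\<in>X0. card (Y x))" unfolding pairs_def
      using finX 3 Y by (intro card_SigmaI) auto
    also have "\<dots> \<le> (\<Sum>x\<in>X0. q)" using finX Y by (intro sum_mono) (auto intro: less_imp_le)
    also have "\<dots> \<le> q\<^sup>2" using finX(2)[OF 3(1)] by (simp add: power2_eq_square)
    finally have card_pairs: "card pairs \<le> q\<^sup>2" .
    have finc: "finite (containing A Z)" for Z using finA by (simp add: containing_def)
    have sub: "F \<subseteq> F' \<union> (\<Union>(x, y)\<in>pairs. containing A {x, y})"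
    proof
      fix S assume S: "S \<in> F"
      show "S \<in> F' \<union> (\<Union>(x, y)\<in>pairs. containing A {x, y})"
      proof (cases "S \<in> F'")
        case False
        then obtain X where X: "X \<in> \<X>" "X \<subseteq> S" using S cover by blast
        obtain x where x: "x \<in> X" "x \<in> X0" using meet[OF X(1) 3(1)] by blast
        obtain y where y: "y \<in> X" "y \<in> Y x" using meet[OF X(1) Y(1)] by blast
        show ?thesis using x y X S F by (auto simp: pairs_def containing_def)
      qed auto
    qed
    have "card F \<le> card (F' \<union> (\<Union>(x, y)\<in>pairs. containing A {x, y}))"
      using fin finc F' finF by (intro card_mono sub) (auto intro: finite_subset)
    also have "\<dots> \<le> card F' + (\<Sum>p\<in>pairs. card (case p of (x, y) \<Rightarrow> containing A {x, y}))"
      by (rule order_trans[OF card_Un_le add_left_mono[OF card_UN_le[OF fin]]])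
    finally have "real (card F) \<le> real (card F' + (\<Sum>p\<in>pairs. card (case p of (x, y) \<Rightarrow> containing A {x, y})))"
      by (simp only: of_nat_le_iff)
    also have "\<dots> = real (card F') + (\<Sum>p\<in>pairs. real (card (case p of (x, y) \<Rightarrow> containing A {x, y})))"
      by simp
    also have "(\<Sum>p\<in>pairs. real (card (case p of (x, y) \<Rightarrow> containing A {x, y})))
        \<le> (\<Sum>p\<in>pairs. real (card A) / s\<^sup>2)"
    proof (rule sum_mono, clarify)
      fix x y assume "(x, y) \<in> pairs"
      then have "x \<noteq> y" using Y(2)[of x] by (auto simp: pairs_def)
      then have "card {x, y} = 2" by simp
      moreover have "s ^ card {x, y} * real (card (containing A {x, y})) \<le> real (card A)"
        using s by (simp add: spread_def)
      ultimately show "real (card (containing A {x, y})) \<le> real (card A) / s\<^sup>2"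
        using r by (simp add: field_simps)
    qed
    also have "\<dots> = real (card pairs) * (real (card A) / s\<^sup>2)" by simp
    also have "\<dots> \<le> (real q)\<^sup>2 * (real (card A) / s\<^sup>2)"
      using card_pairs by (intro mult_right_mono) (auto simp flip: of_nat_power)
    finally show ?thesis using F'(2) by (simp add: power_divide distrib_right)
  qed
qed

section \<open>Permutations with prescribed values\<close>

text \<open>An arbitrary ground set is allowed because the inductions delete and insert
  points.\<close>

definition perms :: "'a set \<Rightarrow> nat \<Rightarrow> ('a \<Rightarrow> 'a) set" where
  "perms V j = {p. p permutes V \<and> num_cycles_on V p = j}"

lemma Sym_cycles_eq_perms: "Sym_cycles n k = perms {1..n} k"
  by (simp add: Sym_cycles_def perms_def)

lemma finite_perms [simp]: "finite V \<Longrightarrow> finite (perms V j)"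
  by (rule finite_subset[OF _ finite_permutations]) (auto simp: perms_def)

lemma perms_0 [simp]:
  assumes "finite V" "V \<noteq> {}"
  shows "perms V 0 = {}"
  using assms by (auto simp: perms_def num_cycles_on_def)

text \<open>The composition inserts \<open>a\<close> directly in front of \<open>b\<close> in the
  cycle of \<open>b\<close>; for \<open>a = b\<close> it leaves \<open>a\<close> as a new fixed
  point. Only the second case changes the number of cycles.\<close>

lemma transpose_comp_in_perms_insert:
  assumes S: "finite S" "a \<notin> S" and b: "b \<in> insert a S" and j: "j \<ge> 1"
    and p: "p \<in> perms S (j - (if a = b then 1 else 0))"
  shows "transpose a b \<circ> p \<in> perms (insert a S) j" and "(transpose a b \<circ> p) a = b"
proof -
  have pS: "p permutes S" using p by (simp add: perms_def)
  have "transpose a b \<circ> p permutes insert a S"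
    using b by (intro permutes_compose permutes_swap_id permutes_subset[OF pS]) auto
  moreover have "num_cycles_on (insert a S) (transpose a b \<circ> p) = j"
    using num_cycles_on_transpose_comp[OF pS S b] p j by (auto simp: perms_def)
  ultimately show "transpose a b \<circ> p \<in> perms (insert a S) j" by (simp add: perms_def)
  show "(transpose a b \<circ> p) a = b" using pS S by (simp add: permutes_not_in)
qed

lemma transpose_comp_in_perms:
  assumes S: "finite S" "a \<notin> S" and b: "b \<in> insert a S"
    and q: "q \<in> perms (insert a S) j" "q a = b"
  shows "transpose a b \<circ> q \<in> perms S (j - (if a = b then 1 else 0))"
proof -
  have q': "q permutes insert a S" "num_cycles_on (insert a S) q = j"
    using q by (auto simp: perms_def)
  have "transpose a b \<circ> q permutes insert a S"
    using b by (intro permutes_compose[OF q'(1)] permutes_swap_id) auto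
  then have p: "transpose a b \<circ> q permutes S"
    by (rule permutes_superset) (use q in auto)
  have "transpose a b \<circ> (transpose a b \<circ> q) = q" by (simp flip: comp_assoc)
  then have "num_cycles_on S (transpose a b \<circ> q) = j - (if a = b then 1 else 0)"
    using num_cycles_on_transpose_comp[OF p S b] q'(2) by auto
  then show ?thesis using p by (simp add: perms_def)
qed

lemma bij_betw_perms_insert:
  assumes "finite S" "a \<notin> S" "b \<in> insert a S" "j \<ge> 1"
  shows "bij_betw (\<lambda>p. transpose a b \<circ> p) (perms S (j - (if a = b then 1 else 0)))
    {q \<in> perms (insert a S) j. q a = b}"
proof (rule bij_betw_byWitness[where f' = "\<lambda>q. transpose a b \<circ> q"])
  show "(\<lambda>p. transpose a b \<circ> p) ` perms S (j - (if a = b then 1 else 0))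
      \<subseteq> {q \<in> perms (insert a S) j. q a = b}"
    using transpose_comp_in_perms_insert[OF assms] by blast
  show "(\<lambda>q. transpose a b \<circ> q) ` {q \<in> perms (insert a S) j. q a = b}
      \<subseteq> perms S (j - (if a = b then 1 else 0))"
    using transpose_comp_in_perms[OF assms(1-3)] by blast
qed (simp_all flip: comp_assoc)

lemma card_perms_fixed_value:
  assumes "finite S" "a \<notin> S" "b \<in> insert a S" "j \<ge> 1"
  shows "card {q \<in> perms (insert a S) j. q a = b} = card (perms S (j - (if a = b then 1 else 0)))"
  using bij_betw_same_card[OF bij_betw_perms_insert[OF assms]] by simp

lemma card_perms: "finite V \<Longrightarrow> card (perms V j) = stirling (card V) j"
proof (induction V arbitrary: j rule: finite_induct)
  case empty
  have "perms {} j = (if j = 0 then {id :: 'a \<Rightarrow> 'a} else {})"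
    by (auto simp: perms_def num_cycles_on_def)
  then show ?case by (cases j) auto
next
  case (insert a S)
  show ?case
  proof (cases j)
    case 0
    then show ?thesis using insert by simp
  next
    case (Suc i)
    have "perms (insert a S) j = (\<Union>b\<in>insert a S. {q \<in> perms (insert a S) j. q a = b})"
      by (auto simp: perms_def permutes_in_image dest: permutes_in_image[of _ _ a])
    then have "card (perms (insert a S) j)
        = card (\<Union>b\<in>insert a S. {q \<in> perms (insert a S) j. q a = b})" by simp
    also have "\<dots> = (\<Sum>b\<in>insert a S. card {q \<in> perms (insert a S) j. q a = b})"
      using insert.hyps by (intro card_UN_disjoint) auto
    also have "\<dots> = (\<Sum>b\<in>insert a S. stirling (card S) (j - (if a = b then 1 else 0)))"
      using insert Suc by (intro sum.cong refl) (subst card_perms_fixed_value, auto)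
    also have "\<dots> = stirling (card S) i + (\<Sum>b\<in>S. stirling (card S) j)"
    proof -
      have "(\<Sum>b\<in>S. stirling (card S) (j - (if a = b then 1 else 0))) = (\<Sum>b\<in>S. stirling (card S) j)"
        using insert.hyps by (intro sum.cong) auto
      then show ?thesis using insert.hyps Suc by simp
    qed
    finally show ?thesis using insert Suc by simp
  qed
qed

text \<open>The prescribed values are contracted one by one. A contraction loses one point, keeps
  the number of cycles or lowers it by one, and is paid for by \<open>step\<close>, which can be
  applied as long as \<open>m0\<close> points remain.\<close>

lemma card_perms_prescribed_le:
  fixes r :: real
  assumes r: "r \<ge> 0"
    and step: "\<And>m i. m0 \<le> m \<Longrightarrow> 1 \<le> i \<Longrightarrow> i \<le> k \<Longrightarrow>
      r * stirling m i \<le> stirling (Suc m) i \<and> r * stirling m (i - 1) \<le> stirling (Suc m) i"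
  shows "finite V \<Longrightarrow> X \<subseteq> V \<times> V \<Longrightarrow> m0 + card X \<le> card V \<Longrightarrow> j \<le> k \<Longrightarrow>
    r ^ card X * real (card {q \<in> perms V j. \<forall>(x, y)\<in>X. q x = y}) \<le> real (stirling (card V) j)"
proof (induction "card X" arbitrary: X V j)
  case 0
  then have "X = {}" using finite_subset by (metis card_0_eq finite_cartesian_product)
  then show ?case using 0 by (simp add: card_perms)
next
  case (Suc t)
  let ?Q = "{q \<in> perms V j. \<forall>(x, y)\<in>X. q x = y}"
  show ?case
  proof (cases "?Q = {}")
    case False
    \<comment> \<open>The permutation \<open>q0\<close> certifies that \<open>X\<close> is the graph
      of a partial injection. Hence no other pair starts at \<open>a\<close>, and the contracted
      pairs stay inside \<open>S \<times> S\<close>.\<close>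
    then obtain q0 where "q0 \<in> ?Q" by blast
    then have q0: "q0 \<in> perms V j" "\<And>x y. (x, y) \<in> X \<Longrightarrow> q0 x = y" by auto
    have finX: "finite X" using Suc finite_subset by fastforce
    obtain a b where ab: "(a, b) \<in> X" using Suc(2) by (metis card.empty ex_in_conv nat.distinct(1) surj_pair)
    define S where "S = V - {a}"
    have V: "V = insert a S" "a \<notin> S" "b \<in> insert a S" "finite S" using ab Suc by (auto simp: S_def)
    have j: "j \<ge> 1" using q0(1) V by (cases j) auto
    define i where "i = j - (if a = b then 1 else 0)"
    define X' where "X' = (\<lambda>(c, d). (c, transpose a b d)) ` (X - {(a, b)})"
    let ?f = "\<lambda>q. transpose a b \<circ> q"
    have fS: "?f q \<in> perms S i" if "q \<in> perms V j" "q a = b" for q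
      unfolding i_def using that V(1) by (intro transpose_comp_in_perms[OF V(4,2,3)]) auto
    have other: "c \<noteq> a" if "(c, d) \<in> X - {(a, b)}" for c d
      using that ab q0(2) by (metis DiffE insertI1)
    have q0S: "?f q0 permutes S"
      using fS[OF q0(1) q0(2)[OF ab]] by (simp add: perms_def)
    have X'S: "X' \<subseteq> S \<times> S"
    proof -
      have "c \<in> S \<and> transpose a b d \<in> S" if cd: "(c, d) \<in> X - {(a, b)}" for c d
      proof -
        have "c \<in> S" using other[OF cd] cd Suc by (auto simp: S_def)
        moreover have "?f q0 c = transpose a b d" using q0(2)[of c d] cd by simp
        ultimately show ?thesis using permutes_in_image[OF q0S, of c] by simp
      qed
      then show ?thesis by (auto simp: X'_def)
    qed
    have cX': "card X' = t"
    proof -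
      have "card X' = card (X - {(a, b)})" unfolding X'_def
        by (rule card_image) (auto simp: inj_on_def dest: arg_cong[where f = "transpose a b"])
      then show ?thesis using ab finX Suc(2) by simp
    qed
    have "?f ` ?Q \<subseteq> {p \<in> perms S i. \<forall>(x, y)\<in>X'. p x = y}"
    proof (rule image_subsetI)
      fix q assume q: "q \<in> ?Q"
      then have "?f q \<in> perms S i" using ab by (intro fS) auto
      moreover have "\<forall>(x, y)\<in>X'. ?f q x = y" using q by (auto simp: X'_def)
      ultimately show "?f q \<in> {p \<in> perms S i. \<forall>(x, y)\<in>X'. p x = y}" by simp
    qed
    moreover have "inj_on ?f ?Q"
      by (rule inj_on_inverseI[where g = ?f]) (simp flip: comp_assoc)
    ultimately have "card ?Q \<le> card {p \<in> perms S i. \<forall>(x, y)\<in>X'. p x = y}"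
      using V by (intro card_inj_on_le) auto
    then have "r ^ Suc t * real (card ?Q) \<le> r ^ Suc t * real (card {p \<in> perms S i. \<forall>(x, y)\<in>X'. p x = y})"
      using r by (intro mult_left_mono) auto
    also have "\<dots> = r * (r ^ card X' * real (card {p \<in> perms S i. \<forall>(x, y)\<in>X'. p x = y}))"
      by (simp add: cX')
    also have "\<dots> \<le> r * real (stirling (card S) i)"
    proof (intro mult_left_mono Suc(1))
      show "m0 + card X' \<le> card S" using Suc(2,5) V cX' by simp
    qed (use cX' V X'S r Suc(6) in \<open>auto simp: i_def\<close>)
    also have "\<dots> \<le> real (stirling (card V) j)"
    proof -
      have "m0 \<le> card S" using Suc(2,5) V by simp
      from step[OF this j] show ?thesis using V Suc(6) by (auto simp: i_def)
    qed
    finally show ?thesis using Suc(2) by simp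
  next
    case True
    then show ?thesis by (simp only: card.empty)
  qed
qed

section \<open>Ratios of neighbouring Stirling numbers\<close>

lemma stirling_pos: "1 \<le> k \<Longrightarrow> k \<le> n \<Longrightarrow> 0 < stirling n k"
proof (induction n arbitrary: k)
  case (Suc n)
  then obtain i where k: "k = Suc i" by (cases k) auto
  show ?case
  proof (cases "k = Suc n")
    case True
    then show ?thesis by simp
  next
    case False
    then have "n \<ge> 1" "stirling n k > 0" using Suc by auto
    then show ?thesis by (simp add: k)
  qed
qed simp

text \<open>Expand row \<open>m + 1\<close> by the recurrence. The inner induction on
  \<open>m\<close> handles the part multiplied by \<open>m\<close>, the outer one on
  \<open>j\<close> the part from the lower index, and the new summand \<open>1 / m\<close> cancels
  the factor \<open>m\<close> and leaves one extra copy of \<open>c(m, j + 1)\<close>.\<close>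

lemma stirling_ratio_ge:
  "1 \<le> j \<Longrightarrow> (\<Sum>i\<in>{j..<m}. 1 / real i) * real (stirling m j) \<le> real j * real (stirling m (Suc j))"
proof (induction j arbitrary: m)
  case (Suc j)
  note IHj = Suc.IH
  show ?case
  proof (induction m)
    case 0
    show ?case by simp
  next
    case (Suc m)
    define s where "s = (\<Sum>i\<in>{Suc j..<m}. 1 / real i)"
    show ?case
    proof (cases "m \<le> j")
      case True
      then show ?thesis by simp
    next
      case False
      then have m: "m \<ge> 1" "Suc j \<le> m" by auto
      have s': "(\<Sum>i\<in>{Suc j..<Suc m}. 1 / real i) = s + 1 / real m"
        using m by (simp add: s_def)
      \<comment> \<open>The sum belonging to \<open>j\<close> starts one index earlier, and its
        additional summand \<open>1 / j\<close> is at least \<open>1 / m\<close>.\<close>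
      have prev: "(s + 1 / real m) * real (stirling m j) \<le> real j * real (stirling m (Suc j))"
      proof (cases "j = 0")
        case True
        then show ?thesis using m by (cases m) auto
      next
        case False
        have "{j..<m} = insert j {Suc j..<m}" using m by auto
        then have eq: "(\<Sum>i\<in>{j..<m}. 1 / real i) = 1 / real j + s" by (simp add: s_def)
        have "1 / real m \<le> 1 / real j" using m False by (intro divide_left_mono) auto
        then have "(s + 1 / real m) * real (stirling m j) \<le> (1 / real j + s) * real (stirling m j)"
          by (intro mult_right_mono) auto
        also have "\<dots> \<le> real j * real (stirling m (Suc j))"
          using IHj[of m] False eq by simp
        finally show ?thesis .
      qed
      have "(s + 1 / real m) * real (stirling (Suc m) (Suc j))
          = real m * (s * real (stirling m (Suc j))) + real (stirling m (Suc j))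
            + (s + 1 / real m) * real (stirling m j)"
        using m by (simp add: field_simps)
      also have "\<dots> \<le> real m * (real (Suc j) * real (stirling m (Suc (Suc j)))) + real (stirling m (Suc j))
            + real j * real (stirling m (Suc j))"
        using Suc.IH prev by (intro add_mono mult_left_mono) (auto simp: s_def)
      also have "\<dots> = real (Suc j) * real (stirling (Suc m) (Suc (Suc j)))"
        by (simp add: algebra_simps)
      finally show ?thesis using s' by simp
    qed
  qed
qed simp

text \<open>At least half of the \<open>m\<close> possible summands occur in the harmonic sum, each
  at least \<open>1 / m\<close>. The logarithm in that sum is given away.\<close>

lemma stirling_le_next:
  assumes "1 \<le> j" "2 * j \<le> m"
  shows "stirling m j \<le> 2 * j * stirling m (Suc j)"
proof -
  have "1 / 2 \<le> real (m - j) * (1 / real m)" using assms by (simp add: of_nat_diff field_simps)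
  also have "\<dots> = (\<Sum>i\<in>{j..<m}. 1 / real m)" by simp
  also have "\<dots> \<le> (\<Sum>i\<in>{j..<m}. 1 / real i)"
    using assms by (intro sum_mono divide_left_mono) auto
  finally have "1 / 2 * real (stirling m j) \<le> (\<Sum>i\<in>{j..<m}. 1 / real i) * real (stirling m j)"
    by (intro mult_right_mono) auto
  also have "\<dots> \<le> real j * real (stirling m (Suc j))" using assms by (intro stirling_ratio_ge)
  finally have "real (stirling m j) \<le> real (2 * j * stirling m (Suc j))" by simp
  then show ?thesis by (simp only: of_nat_le_iff)
qed

text \<open>These are the two outcomes of a contraction. Keeping the number of cycles gains a factor
  \<open>m\<close>; lowering it costs up to \<open>2 * k\<close> of that gain, which determines the
  attainable spread.\<close>

lemma stirling_Suc_ge: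
  assumes "1 \<le> i" "i \<le> k" "2 * k \<le> m" "real m0 \<le> real m"
  shows "real m0 / (2 * real k) * stirling m i \<le> stirling (Suc m) i"
    and "real m0 / (2 * real k) * stirling m (i - 1) \<le> stirling (Suc m) i"
proof -
  obtain j where i: "i = Suc j" using assms by (cases i) auto
  have k: "real k \<ge> 1" using assms by simp
  have 1: "real m0 * stirling m i \<le> stirling (Suc m) i"
  proof -
    have "real m0 * stirling m i \<le> real m * stirling m i" using assms by (intro mult_right_mono) auto
    then show ?thesis by (simp add: i)
  qed
  have "real m0 / (2 * real k) \<le> real m0" using k mult_left_mono[of 1 "2 * real k" "real m0"] by (simp add: field_simps)
  then have "real m0 / (2 * real k) * stirling m i \<le> real m0 * stirling m i"
    by (intro mult_right_mono) auto
  with 1 show "real m0 / (2 * real k) * stirling m i \<le> stirling (Suc m) i" by linarith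
  have "stirling m (i - 1) \<le> 2 * k * stirling m i"
  proof (cases "j = 0")
    case True
    then show ?thesis using assms i by (cases m) auto
  next
    case False
    then have "stirling m j \<le> 2 * j * stirling m (Suc j)" using assms i by (intro stirling_le_next) auto
    also have "\<dots> \<le> 2 * k * stirling m i" using assms i by (intro mult_mono) auto
    finally show ?thesis by (simp add: i)
  qed
  then have "real (stirling m (i - 1)) \<le> real (2 * k * stirling m i)" by (simp only: of_nat_le_iff)
  then have "real m0 / (2 * real k) * stirling m (i - 1) \<le> real m0 / (2 * real k) * real (2 * k * stirling m i)"
    by (intro mult_left_mono) auto
  also have "\<dots> = real m0 * stirling m i" using k by simp
  finally show "real m0 / (2 * real k) * stirling m (i - 1) \<le> stirling (Suc m) i" using 1 by linarith
qed

section \<open>Permutations avoiding an injection\<close>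

text \<open>The values of \<open>g\<close> may leave \<open>V\<close>: when points are deleted, only
  an injection remains of the permutation that is to be avoided.\<close>

definition avoiders :: "'a set \<Rightarrow> ('a \<Rightarrow> 'a) \<Rightarrow> nat \<Rightarrow> ('a \<Rightarrow> 'a) set" where
  "avoiders V g j = {p \<in> perms V j. \<forall>l\<in>V. p l \<noteq> g l}"

lemma finite_avoiders [simp]: "finite V \<Longrightarrow> finite (avoiders V g j)"
  by (simp add: avoiders_def)

lemma avoiders_0 [simp]: "finite V \<Longrightarrow> V \<noteq> {} \<Longrightarrow> avoiders V g 0 = {}"
  by (simp add: avoiders_def)

text \<open>A new point \<open>a\<close> is inserted into a cycle in front of \<open>b\<close>; this creates a coincidence with
  \<open>g\<close> only if \<open>b\<close> lies in the set whose size is bounded by \<open>e\<close>.\<close>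

lemma card_avoiders_insert_ge:
  fixes g :: "'a \<Rightarrow> 'a"
  assumes S: "finite S" "a \<notin> S" and j: "j \<ge> 1"
    and E: "\<And>p. p \<in> avoiders S g j \<Longrightarrow> card {b \<in> S. b = g a \<or> (\<exists>l\<in>S. p l = b \<and> g l = a)} \<le> e"
  shows "(card S - e) * card (avoiders S g j) \<le> card {q \<in> avoiders (insert a S) g j. q a \<noteq> a}"
proof -
  \<comment> \<open>Insertion in front of \<open>b\<close> changes two values: \<open>a\<close> is
    sent to \<open>b\<close>, and the former preimage of \<open>b\<close> is sent to
    \<open>a\<close>. The set collects the \<open>b\<close> for which one of these agrees with
    \<open>g\<close>.\<close>
  define X where "X p = {b \<in> S. b = g a \<or> (\<exists>l\<in>S. p l = b \<and> g l = a)}" for p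
  define Y where "Y = (SIGMA p:avoiders S g j. S - X p)"
  define f where "f = (\<lambda>(p :: 'a \<Rightarrow> 'a, b). transpose a b \<circ> p)"
  have fa: "(transpose a b \<circ> p) a = b" "transpose a b \<circ> p \<in> perms (insert a S) j"
    if "p \<in> avoiders S g j" "b \<in> S" for p b
  proof -
    have "a \<noteq> b" using that S by auto
    then have "p \<in> perms S (j - (if a = b then 1 else 0))" "b \<in> insert a S"
      using that by (auto simp: avoiders_def)
    note * = transpose_comp_in_perms_insert[OF S this(2) j this(1)]
    show "(transpose a b \<circ> p) a = b" by (rule *(2))
    show "transpose a b \<circ> p \<in> perms (insert a S) j" by (rule *(1))
  qed
  have "inj_on f Y"
  proof (rule inj_onI)
    fix x y assume xy: "x \<in> Y" "y \<in> Y" "f x = f y"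
    obtain p b where x: "x = (p, b)" by (cases x)
    obtain q c where y: "y = (q, c)" by (cases y)
    have "(transpose a b \<circ> p) a = b" "(transpose a c \<circ> q) a = c"
      by (rule fa(1); use xy x y in \<open>auto simp: Y_def\<close>)+
    moreover have eq: "transpose a b \<circ> p = transpose a c \<circ> q" using xy x y by (simp add: f_def)
    ultimately have bc: "b = c" by simp
    have "transpose a b \<circ> (transpose a b \<circ> p) = transpose a b \<circ> (transpose a b \<circ> q)"
      using eq bc by simp
    then have "p = q" by (simp flip: comp_assoc)
    with bc show "x = y" by (simp add: x y)
  qed
  moreover have "f ` Y \<subseteq> {q \<in> avoiders (insert a S) g j. q a \<noteq> a}"
  proof (rule image_subsetI)
    fix x assume "x \<in> Y"
    then obtain p b where x: "x = (p, b)" and p: "p \<in> avoiders S g j" and b: "b \<in> S" "b \<notin> X p"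
      by (auto simp: Y_def)
    have "(transpose a b \<circ> p) l \<noteq> g l" if l: "l \<in> insert a S" for l
    proof (cases "l = a")
      case True
      then show ?thesis using b fa(1)[OF p b(1)] by (auto simp: X_def)
    next
      case False
      then have lS: "l \<in> S" using l by simp
      have "p permutes S" using p by (simp add: avoiders_def perms_def)
      then have "p l \<noteq> a" using lS S permutes_in_image by metis
      moreover have "p l \<noteq> g l" using p lS by (simp add: avoiders_def)
      moreover have "p l = b \<Longrightarrow> g l \<noteq> a" using b lS by (auto simp: X_def)
      ultimately show ?thesis by (cases "p l = b") auto
    qed
    moreover have "(transpose a b \<circ> p) a \<noteq> a" using fa(1)[OF p b(1)] b S by auto
    ultimately show "f x \<in> {q \<in> avoiders (insert a S) g j. q a \<noteq> a}"
      using fa(2)[OF p b(1)] unfolding x f_def avoiders_def by simp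
  qed
  ultimately have "card Y \<le> card {q \<in> avoiders (insert a S) g j. q a \<noteq> a}"
    using S by (intro card_inj_on_le) auto
  moreover have "card Y = (\<Sum>p\<in>avoiders S g j. card (S - X p))"
    unfolding Y_def using S by (intro card_SigmaI) auto
  moreover have "(\<Sum>p\<in>avoiders S g j. card S - e) \<le> (\<Sum>p\<in>avoiders S g j. card (S - X p))"
  proof (rule sum_mono)
    fix p assume "p \<in> avoiders S g j"
    from E[OF this] have "card (X p) \<le> e" by (simp add: X_def)
    moreover have "card (S - X p) = card S - card (X p)"
      using S by (intro card_Diff_subset) (auto simp: X_def)
    ultimately show "card S - e \<le> card (S - X p)" by simp
  qed
  ultimately show ?thesis by (simp add: mult.commute)
qed

text \<open>As \<open>g\<close> sends \<open>a\<close> and nothing else to \<open>a\<close>, no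
  position \<open>b\<close> is forbidden.\<close>

lemma card_avoiders_insert_fixed_ge:
  assumes S: "finite S" "a \<notin> S" and j: "j \<ge> 1" and g: "inj_on g (insert a S)" "g a = a"
  shows "card S * card (avoiders S g j) \<le> card (avoiders (insert a S) g j)"
proof -
  have E: "{b \<in> S. b = g a \<or> (\<exists>l\<in>S. p l = b \<and> g l = a)} = {}" for p
    using g S by (auto simp: inj_on_def)
  have "card S * card (avoiders S g j) \<le> card {q \<in> avoiders (insert a S) g j. q a \<noteq> a}"
    using card_avoiders_insert_ge[OF S j, of g 0] by (simp add: E)
  also have "\<dots> \<le> card (avoiders (insert a S) g j)" using S by (intro card_mono) auto
  finally show ?thesis .
qed

text \<open>Forbidden are \<open>g a\<close> and the image under \<open>p\<close> of the preimage of
  \<open>a\<close> under \<open>g\<close>. Moreover \<open>a\<close> may become a fixed point.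
  Together this is the Stirling recurrence shifted by two points.\<close>

lemma card_avoiders_insert_nonfixed_ge:
  assumes S: "finite S" "a \<notin> S" and j: "j \<ge> 1" and g: "inj_on g (insert a S)" "g a \<noteq> a"
  shows "(card S - 2) * card (avoiders S g j) + card (avoiders S g (j - 1))
    \<le> card (avoiders (insert a S) g j)"
proof -
  have "card {b \<in> S. b = g a \<or> (\<exists>l\<in>S. p l = b \<and> g l = a)} \<le> 2" for p
  proof -
    let ?L = "{l \<in> S. g l = a}"
    have "card ?L \<le> 1"
      by (rule card_le_Suc0_iff_eq[THEN iffD2, folded One_nat_def]) (use S g in \<open>auto simp: inj_on_def\<close>)
    then have "card (p ` ?L) \<le> 1" using S card_image_le[of ?L p] by simp
    then have "card ({g a} \<union> p ` ?L) \<le> 2"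
      using card_Un_le[of "{g a}" "p ` ?L"] by simp
    moreover have "{b \<in> S. b = g a \<or> (\<exists>l\<in>S. p l = b \<and> g l = a)} \<subseteq> {g a} \<union> p ` ?L" by auto
    moreover have "finite ({g a} \<union> p ` ?L)" using S by simp
    ultimately show ?thesis using card_mono order_trans by meson
  qed
  then have 1: "(card S - 2) * card (avoiders S g j) \<le> card {q \<in> avoiders (insert a S) g j. q a \<noteq> a}"
    by (intro card_avoiders_insert_ge[OF S j])
  have "avoiders S g (j - 1) \<subseteq> {q \<in> avoiders (insert a S) g j. q a = a}"
  proof
    fix p assume p: "p \<in> avoiders S g (j - 1)"
    have "p \<in> perms (insert a S) j" "p a = a"
      using transpose_comp_in_perms_insert[OF S _ j, of a p] p by (auto simp: avoiders_def)
    then show "p \<in> {q \<in> avoiders (insert a S) g j. q a = a}"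
      using p g by (auto simp: avoiders_def)
  qed
  then have 2: "card (avoiders S g (j - 1)) \<le> card {q \<in> avoiders (insert a S) g j. q a = a}"
    using S by (intro card_mono) auto
  have "card (avoiders (insert a S) g j) = card ({q \<in> avoiders (insert a S) g j. q a \<noteq> a}
      \<union> {q \<in> avoiders (insert a S) g j. q a = a})" by (rule arg_cong[where f = card]) auto
  also have "\<dots> = card {q \<in> avoiders (insert a S) g j. q a \<noteq> a}
      + card {q \<in> avoiders (insert a S) g j. q a = a}"
    using S by (intro card_Un_disjoint) auto
  finally show ?thesis using 1 2 by simp
qed

text \<open>This supplies a positive starting value for the recurrence. The cycle \<open>a\<close>,
  \<open>b\<close>, \<open>c\<close> is chosen point by point. For \<open>c\<close> at most four
  points are excluded, namely \<open>a\<close>, \<open>b\<close>, \<open>g b\<close> and the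
  preimage of \<open>a\<close>; hence five points suffice.\<close>

lemma three_cycle_avoiding:
  assumes W: "finite W" "card W \<ge> 5" and g: "inj_on g W"
  shows "\<exists>B\<subseteq>W. card B = 3 \<and> avoiders B g 1 \<noteq> {}"
proof -
  have pick: "\<exists>x\<in>W. x \<notin> Z" if "finite Z" "card Z < card W" for Z
    using that by (meson card_mono leD subsetI)
  obtain a where a: "a \<in> W" using pick[of "{}"] W by auto
  have "card {a, g a} \<le> 2" by (simp add: card_insert_if)
  then obtain b where b: "b \<in> W" "b \<noteq> a" "b \<noteq> g a" using pick[of "{a, g a}"] W by auto
  let ?L = "{l \<in> W. g l = a}"
  have "card ?L \<le> 1"
    by (rule card_le_Suc0_iff_eq[THEN iffD2, folded One_nat_def]) (use W g in \<open>auto simp: inj_on_def\<close>)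
  moreover have "card {a, b, g b} \<le> 3" by (simp add: card_insert_if)
  ultimately have "card ({a, b, g b} \<union> ?L) \<le> 4" using card_Un_le[of "{a, b, g b}" ?L] by simp
  then obtain c where c: "c \<in> W" "c \<noteq> a" "c \<noteq> b" "c \<noteq> g b" "g c \<noteq> a"
    using pick[of "{a, b, g b} \<union> ?L"] W by auto
  define q where "q = transpose c a \<circ> (transpose b a \<circ> id)"
  have id: "id \<in> perms {a} (Suc 0)" by (simp add: perms_def num_cycles_on_def permutes_id)
  have ba: "transpose b a \<circ> id \<in> perms {b, a} 1"
    by (intro transpose_comp_in_perms_insert(1)) (use b id in auto)
  have "q \<in> perms {c, b, a} 1" unfolding q_def
    by (intro transpose_comp_in_perms_insert(1)) (use b c id in auto)
  moreover have "q c = a" "q b = c" "q a = b" using b c by (auto simp: q_def)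
  ultimately have "q \<in> avoiders {c, b, a} g 1" using b c by (auto simp: avoiders_def)
  moreover have "card {c, b, a} = 3" using b c by simp
  ultimately show ?thesis using a b c by (intro exI[of _ "{c, b, a}"]) auto
qed

text \<open>With three points in \<open>B\<close> the shifted factor
  \<open>card (B \<union> T) - 2\<close> equals \<open>Suc (card T)\<close>, so the lower bound runs
  through the Stirling recurrence exactly, starting from \<open>stirling 1 j\<close>.\<close>

lemma card_avoiders_nonfixed_ge:
  assumes B: "card B = 3" "avoiders B g 1 \<noteq> {}"
  shows "finite T \<Longrightarrow> T \<inter> B = {} \<Longrightarrow> inj_on g (B \<union> T) \<Longrightarrow> (\<And>l. l \<in> T \<Longrightarrow> g l \<noteq> l) \<Longrightarrow> j \<ge> 1 \<Longrightarrow>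
    stirling (Suc (card T)) j \<le> card (avoiders (B \<union> T) g j)"
proof (induction T arbitrary: j rule: finite_induct)
  case empty
  have finB: "finite B" using B by (intro card_ge_0_finite) simp
  show ?case
  proof (cases "j = 1")
    case True
    have "card (avoiders B g 1) > 0" using B finB by (simp add: card_gt_0_iff)
    then show ?thesis using True by simp
  next
    case False
    then obtain i where "j = Suc (Suc i)" using empty by (metis One_nat_def Suc_le_D le_antisym not_less_eq_eq)
    then show ?thesis by simp
  qed
next
  case (insert a T)
  have finB: "finite B" using B by (intro card_ge_0_finite) simp
  obtain i where j: "j = Suc i" using insert.prems by (cases j) auto
  have c: "card (B \<union> T) = 3 + card T"
    using insert finB B by (subst card_Un_disjoint) auto
  have inj: "inj_on g (B \<union> T)" using insert.prems(2) by (rule inj_on_subset) auto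
  have 1: "stirling (Suc (card T)) j \<le> card (avoiders (B \<union> T) g j)"
    using insert inj by (intro insert.IH) auto
  have 2: "stirling (Suc (card T)) i \<le> card (avoiders (B \<union> T) g i)"
  proof (cases "i = 0")
    case False
    then show ?thesis using insert inj by (intro insert.IH) auto
  qed simp
  have "stirling (Suc (card (insert a T))) j = Suc (card T) * stirling (Suc (card T)) j + stirling (Suc (card T)) i"
    using insert.hyps j by simp
  also have "\<dots> \<le> Suc (card T) * card (avoiders (B \<union> T) g j) + card (avoiders (B \<union> T) g i)"
    using 1 2 by (intro add_mono mult_left_mono) auto
  also have "\<dots> = (card (B \<union> T) - 2) * card (avoiders (B \<union> T) g j) + card (avoiders (B \<union> T) g (j - 1))"
    using c j by simp
  also have "\<dots> \<le> card (avoiders (insert a (B \<union> T)) g j)"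
    using insert finB by (intro card_avoiders_insert_nonfixed_ge) auto
  finally show ?case by simp
qed

lemma stirling_Suc_le:
  assumes "1 \<le> j" "j \<le> k" "2 * k \<le> m"
  shows "stirling (Suc m) j \<le> (m + 2 * k) * stirling m j"
proof -
  obtain i where j: "j = Suc i" using assms by (cases j) auto
  have "stirling m i \<le> 2 * k * stirling m j"
  proof (cases "i = 0")
    case True
    then show ?thesis using assms j by (cases m) auto
  next
    case False
    then have "stirling m i \<le> 2 * i * stirling m (Suc i)" using assms j by (intro stirling_le_next) auto
    also have "\<dots> \<le> 2 * k * stirling m (Suc i)" using assms j by (intro mult_mono) auto
    finally show ?thesis by (simp add: j)
  qed
  then show ?thesis by (simp add: j algebra_simps)
qed

text \<open>A fixed point of \<open>g\<close> multiplies the avoiders by the number \<open>v\<close>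
  of points already present, whereas the Stirling number grows by at most \<open>v + 2 * k\<close>.
  The loss is at most the factor \<open>1 - 2 * k / m\<close> once \<open>m\<close> points are
  there, which is why fixed points are inserted last.\<close>

lemma card_avoiders_add_fixed_ge:
  fixes g :: "'a \<Rightarrow> 'a"
  assumes W: "finite W" "m \<le> card W" "2 * k + 2 \<le> m" and j: "1 \<le> j" "j \<le> k"
    and base: "stirling (card W - 2) j \<le> card (avoiders W g j)"
  shows "finite T \<Longrightarrow> T \<inter> W = {} \<Longrightarrow> inj_on g (W \<union> T) \<Longrightarrow> (\<And>l. l \<in> T \<Longrightarrow> g l = l) \<Longrightarrow>
    (1 - 2 * real k / real m) ^ card T * stirling (card (W \<union> T) - 2) j \<le> card (avoiders (W \<union> T) g j)"
proof (induction T rule: finite_induct)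
  case empty
  then show ?case using base by simp
next
  case (insert a T)
  define y where "y = 1 - 2 * real k / real m"
  have y: "0 \<le> y" using W j by (simp add: y_def field_simps)
  define v where "v = card (W \<union> T)"
  have v: "v = card W + card T" using insert W by (simp add: v_def card_Un_disjoint Int_commute)
  then have vm: "m \<le> v" "2 * k \<le> v - 2" "v \<ge> 2" using W by auto
  have va: "card (W \<union> insert a T) = Suc v"
    using insert W by (simp add: v card_Un_disjoint Int_commute)
  have "y ^ card (insert a T) * stirling (card (W \<union> insert a T) - 2) j
      = y ^ card T * (y * stirling (Suc (v - 2)) j)"
  proof -
    have "card (W \<union> insert a T) - 2 = Suc (v - 2)" using va vm by simp
    then show ?thesis using insert.hyps by (simp del: stirling.simps)
  qed
  also have "\<dots> \<le> y ^ card T * (real v * stirling (v - 2) j)"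
  proof (intro mult_left_mono)
    have "stirling (Suc (v - 2)) j \<le> (v - 2 + 2 * k) * stirling (v - 2) j"
      using vm j by (intro stirling_Suc_le) auto
    also have "\<dots> \<le> (v + 2 * k) * stirling (v - 2) j" by (intro mult_right_mono) auto
    finally have "real (stirling (Suc (v - 2)) j) \<le> real ((v + 2 * k) * stirling (v - 2) j)"
      by (simp only: of_nat_le_iff)
    then have "y * stirling (Suc (v - 2)) j \<le> y * ((real v + 2 * real k) * stirling (v - 2) j)"
      using y by (intro mult_left_mono) (auto simp del: stirling.simps)
    also have "\<dots> = (y * (real v + 2 * real k)) * stirling (v - 2) j" by simp
    also have "y * (real v + 2 * real k) \<le> real v"
    proof -
      have "real m * 1 \<le> real v + 2 * real k" using vm by simp
      then have "1 \<le> (real v + 2 * real k) / real m" using W by (simp add: field_simps)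
      then have "2 * real k * 1 \<le> 2 * real k * ((real v + 2 * real k) / real m)"
        by (intro mult_left_mono) auto
      then show ?thesis by (simp add: y_def left_diff_distrib)
    qed
    finally show "y * stirling (Suc (v - 2)) j \<le> real v * stirling (v - 2) j"
      by (simp add: mult_right_mono)
  qed (use y in auto)
  also have "\<dots> = real v * (y ^ card T * stirling (v - 2) j)" by simp
  also have "\<dots> \<le> real v * card (avoiders (W \<union> T) g j)"
  proof (intro mult_left_mono)
    have "inj_on g (W \<union> T)" using insert.prems(2) by (rule inj_on_subset) auto
    then show "y ^ card T * stirling (v - 2) j \<le> card (avoiders (W \<union> T) g j)"
      using insert by (auto simp: v_def y_def)
  qed simp
  also have "\<dots> = real (v * card (avoiders (W \<union> T) g j))" by simp
  also have "\<dots> \<le> card (avoiders (insert a (W \<union> T)) g j)"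
    unfolding v_def of_nat_le_iff using insert W j
    by (intro card_avoiders_insert_fixed_ge) auto
  finally show ?case by (simp add: y_def)
qed

text \<open>The constant is a factor 2 lost to the fixed points of \<open>g\<close> times
  \<open>(2 * v)^2\<close> for the two points by which the recurrence is shifted.\<close>

lemma card_avoiders_ge:
  fixes g :: "'a \<Rightarrow> 'a"
  assumes V: "finite V" and g: "inj_on g V" and j: "1 \<le> j" "j \<le> k"
    and fixed: "card {l \<in> V. g l = l} \<le> k + 1" and big: "9 * (k + 1)\<^sup>2 \<le> card V"
  shows "stirling (card V) j \<le> 8 * (real (card V))\<^sup>2 * card (avoiders V g j)"
proof -
  define T where "T = {l \<in> V. g l = l}"
  define W where "W = V - T"
  define v where "v = card V"
  define m where "m = v - (k + 1)"
  have finWT: "finite W" "finite T" "T \<inter> W = {}" "W \<union> T = V" using V by (auto simp: T_def W_def)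
  have k1: "k + 1 \<le> (k + 1)\<^sup>2" "2 * (k + 1) \<le> (k + 1)\<^sup>2"
    using j by (auto simp: power2_eq_square)
  have m: "real m = real v - real k - 1" "8 * (k + 1)\<^sup>2 \<le> m" using big k1 by (auto simp: m_def v_def)
  have cT: "card T \<le> k + 1" using fixed by (simp add: T_def)
  have cW: "m \<le> card W"
  proof -
    have "card W = v - card T" unfolding W_def v_def using finWT by (intro card_Diff_subset) auto
    then show ?thesis using cT by (simp add: m_def)
  qed
  have W: "card W \<ge> 5" "2 * k + 2 \<le> m" using cW m(2) k1 j by auto
  have injW: "inj_on g W" using g by (rule inj_on_subset) (auto simp: W_def)
  obtain B where B: "B \<subseteq> W" "card B = 3" "avoiders B g 1 \<noteq> {}"
    using three_cycle_avoiding[OF finWT(1) W(1) injW] by blast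
  have "stirling (Suc (card (W - B))) j \<le> card (avoiders (B \<union> (W - B)) g j)"
    using finWT injW B j
    by (intro card_avoiders_nonfixed_ge) (auto simp: W_def T_def intro: inj_on_subset)
  moreover have "Suc (card (W - B)) = card W - 2"
    using B W finWT by (subst card_Diff_subset) (auto intro: finite_subset)
  moreover have "B \<union> (W - B) = W" using B by auto
  ultimately have base: "stirling (card W - 2) j \<le> card (avoiders W g j)" by simp
  have main: "(1 - 2 * real k / real m) ^ card T * stirling (v - 2) j \<le> card (avoiders V g j)"
  proof -
    have "inj_on g (W \<union> T)" "\<And>l. l \<in> T \<Longrightarrow> g l = l" using g finWT(4) by (simp_all add: T_def)
    from card_avoiders_add_fixed_ge[OF finWT(1) cW W(2) j base finWT(2,3) this]
    show ?thesis unfolding finWT(4) v_def .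
  qed
  \<comment> \<open>By Bernoulli's inequality: there are at most \<open>k + 1\<close> factors, each
    within \<open>2 * k / m\<close> of 1, and \<open>m\<close> is at least
    \<open>4 * (k + 1)^2\<close>.\<close>
  have "1 / 2 \<le> 1 + real (card T) * (- (2 * real k / real m))"
  proof -
    have "4 * real (card T) * real k \<le> 4 * real (k + 1) * real (k + 1)"
      using cT by (intro mult_mono) auto
    also have "\<dots> \<le> real m"
    proof -
      have "real (8 * (k + 1)\<^sup>2) \<le> real m" using m(2) by (simp only: of_nat_le_iff)
      moreover have "0 \<le> real k * real k" by simp
      ultimately show ?thesis unfolding power2_eq_square by (simp add: algebra_simps)
    qed
    finally show ?thesis using W by (simp add: field_simps)
  qed
  also have "\<dots> \<le> (1 + - (2 * real k / real m)) ^ card T"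
    by (rule Bernoulli_inequality) (use W in \<open>simp add: field_simps\<close>)
  finally have "1 / 2 * real (stirling (v - 2) j) \<le> (1 - 2 * real k / real m) ^ card T * stirling (v - 2) j"
    by (intro mult_right_mono) auto
  with main have half: "real (stirling (v - 2) j) \<le> 2 * real (card (avoiders V g j))" by simp
  have vk: "2 * k \<le> v - 2" "v \<ge> 2" using big k1 j by (auto simp: v_def)
  \<comment> \<open>Two steps of the recurrence restore the missing points. Each costs at most
    \<open>2 * v\<close>, because \<open>2 * k\<close> is at most \<open>v - 2\<close>.\<close>
  have "stirling v j = stirling (Suc (Suc (v - 2))) j" using vk by (simp only: Suc_diff_le[symmetric] numeral_2_eq_2) simp
  also have "\<dots> \<le> (Suc (v - 2) + 2 * k) * stirling (Suc (v - 2)) j"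
    using vk j by (intro stirling_Suc_le) auto
  also have "\<dots> \<le> (2 * v) * ((v - 2 + 2 * k) * stirling (v - 2) j)"
    using vk j by (intro mult_mono stirling_Suc_le) auto
  also have "\<dots> \<le> (2 * v) * ((2 * v) * stirling (v - 2) j)"
    using vk by (intro mult_mono) auto
  finally have "real (stirling v j) \<le> real ((2 * v) * ((2 * v) * stirling (v - 2) j))"
    by (simp only: of_nat_le_iff)
  also have "\<dots> = (4 * real v * real v) * real (stirling (v - 2) j)" by simp
  also have "\<dots> \<le> (4 * real v * real v) * (2 * real (card (avoiders V g j)))"
    by (intro mult_left_mono half) auto
  finally show ?thesis by (simp add: v_def power2_eq_square mult_ac)
qed

section \<open>Intersecting families of permutations with few cycles\<close>

definition perm_graph :: "'a set \<Rightarrow> ('a \<Rightarrow> 'a) \<Rightarrow> ('a \<times> 'a) set" where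
  "perm_graph V p = (\<lambda>x. (x, p x)) ` V"

lemma inj_on_perm_graph: "inj_on (perm_graph V) {p. p permutes V}"
proof (rule inj_onI)
  fix p q assume *: "p \<in> {p. p permutes V}" "q \<in> {p. p permutes V}" "perm_graph V p = perm_graph V q"
  show "p = q"
  proof
    fix x
    show "p x = q x"
    proof (cases "x \<in> V")
      case True
      then have "(x, p x) \<in> perm_graph V q" using *(3) by (auto simp: perm_graph_def)
      then show ?thesis by (auto simp: perm_graph_def)
    next
      case False
      then show ?thesis using * by (simp add: permutes_not_in)
    qed
  qed
qed

lemma card_perm_graph_image: "F \<subseteq> perms V j \<Longrightarrow> card (perm_graph V ` F) = card F"
  by (rule card_image, rule inj_on_subset[OF inj_on_perm_graph]) (auto simp: perms_def)

text \<open>Each prescribed value gains \<open>b\<close> while \<open>m0\<close> points remain. A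
  larger set \<open>X\<close> is cut down to \<open>card V - m0\<close> pairs; what these gain
  already exceeds \<open>s ^ card V\<close>, which is why \<open>s\<close> has to be slightly
  smaller than \<open>b\<close>.\<close>

lemma spread_perm_graphs:
  fixes b s :: real
  assumes V: "finite V" and k: "1 \<le> k" and m0: "2 * k \<le> m0" "m0 \<le> card V"
    and b: "b \<le> real m0 / (2 * real k)" and s: "1 \<le> s" "s \<le> b" "s ^ card V \<le> b ^ (card V - m0)"
  shows "spread 1 s (perm_graph V ` perms V k)"
proof -
  let ?A = "perm_graph V ` perms V k"
  have card_A: "card ?A = stirling (card V) k"
    using V by (simp add: card_perm_graph_image[OF order_refl] card_perms)
  have finA: "finite ?A" using V by simp
  have step: "b * stirling m i \<le> stirling (Suc m) i \<and> b * stirling m (i - 1) \<le> stirling (Suc m) i"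
    if "m0 \<le> m" "1 \<le> i" "i \<le> k" for m i
  proof -
    have "real m0 / (2 * real k) * stirling m i \<le> stirling (Suc m) i"
      "real m0 / (2 * real k) * stirling m (i - 1) \<le> stirling (Suc m) i"
      using that m0 by (intro stirling_Suc_ge[where k = k]; simp)+
    moreover have "b * stirling m i \<le> real m0 / (2 * real k) * stirling m i"
      "b * stirling m (i - 1) \<le> real m0 / (2 * real k) * stirling m (i - 1)"
      using b by (intro mult_right_mono; simp)+
    ultimately show ?thesis by linarith
  qed
  have small: "b ^ card X * real (card (containing ?A X)) \<le> real (card ?A)"
    if X: "X \<subseteq> V \<times> V" "m0 + card X \<le> card V" for X
  proof -
    have "containing ?A X = perm_graph V ` {p \<in> perms V k. \<forall>(x, y)\<in>X. p x = y}"
      using X(1) by (auto simp: containing_def perm_graph_def image_iff)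
    then have "card (containing ?A X) \<le> card {p \<in> perms V k. \<forall>(x, y)\<in>X. p x = y}"
      using V by (simp add: card_image_le)
    then have "b ^ card X * real (card (containing ?A X))
        \<le> b ^ card X * real (card {p \<in> perms V k. \<forall>(x, y)\<in>X. p x = y})"
      using s by (intro mult_left_mono) auto
    also have "\<dots> \<le> real (stirling (card V) k)"
      by (rule card_perms_prescribed_le[OF _ step V X]) (use s in auto)
    finally show ?thesis by (simp add: card_A)
  qed
  show ?thesis unfolding spread_def
  proof
    fix X
    show "s ^ card X * real (card (containing ?A X)) \<le> 1 * real (card ?A)"
    proof (cases "containing ?A X = {}")
      case False
      then obtain p where p: "p \<in> perms V k" "X \<subseteq> perm_graph V p" by (auto simp: containing_def)
      have "p permutes V" using p by (simp add: perms_def)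
      then have XV: "X \<subseteq> V \<times> V" using p permutes_in_image by (fastforce simp: perm_graph_def)
      have "card X \<le> card (perm_graph V p)" using p V by (intro card_mono) (auto simp: perm_graph_def)
      then have cX: "card X \<le> card V" using V card_image_le[of V "\<lambda>x. (x, p x)"] by (simp add: perm_graph_def)
      show ?thesis
      proof (cases "m0 + card X \<le> card V")
        case True
        have "s ^ card X * real (card (containing ?A X)) \<le> b ^ card X * real (card (containing ?A X))"
          using s by (intro mult_right_mono power_mono) auto
        with small[OF XV True] show ?thesis by linarith
      next
        case False
        then have "card V - m0 \<le> card X" by simp
        then obtain Y where Y: "Y \<subseteq> X" "card Y = card V - m0"
          by (meson obtain_subset_with_card_n)
        have "containing ?A X \<subseteq> containing ?A Y" using Y by (auto simp: containing_def)
        then have "card (containing ?A X) \<le> card (containing ?A Y)"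
          using finA by (intro card_mono) (auto simp: containing_def)
        moreover have "s ^ card X \<le> b ^ card Y"
        proof -
          have "s ^ card X \<le> s ^ card V" using s cX by (intro power_increasing) auto
          then show ?thesis using s Y by simp
        qed
        ultimately have "s ^ card X * real (card (containing ?A X)) \<le> b ^ card Y * real (card (containing ?A Y))"
          using s by (intro mult_mono) auto
        also have "\<dots> \<le> real (card ?A)" using Y XV m0 by (intro small) auto
        finally show ?thesis by simp
      qed
    qed simp
  qed
qed

lemma card_fixed_points_le_num_cycles_on:
  assumes "finite V"
  shows "card {l \<in> V. p l = l} \<le> num_cycles_on V p"
proof -
  have orb: "orbit p l = {l}" if "p l = l" for l using that orbit_eq_singleton_iff by metis
  have "inj_on (orbit p) {l \<in> V. p l = l}" by (rule inj_onI) (auto simp: orb)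
  moreover have "orbit p ` {l \<in> V. p l = l} \<subseteq> orbit p ` V" by auto
  ultimately show ?thesis unfolding num_cycles_on_def
    using assms by (intro card_inj_on_le) auto
qed

text \<open>Contracting \<open>i\<close> turns the condition into avoiding \<open>g\<close> on the
  remaining points; at \<open>i\<close> itself \<open>j\<close> differs from the value of
  \<open>\<sigma>\<close> anyway. A fixed point of \<open>g\<close> other than \<open>j\<close> is
  fixed by \<open>\<sigma>\<close>, so the small number of cycles of \<open>\<sigma>\<close> limits
  them to \<open>k + 1\<close>.\<close>

lemma card_star_avoiding_ge:
  assumes V: "finite V" and ij: "i \<in> V" "j \<in> V" and \<sigma>: "\<sigma> \<in> perms V k" "\<sigma> i \<noteq> j"
    and k: "1 \<le> k'" "k' = k - (if i = j then 1 else 0)" and big: "9 * (k + 1)\<^sup>2 \<le> card V - 1"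
  shows "stirling (card V - 1) k' \<le>
    8 * (real (card V))\<^sup>2 * card {\<tau> \<in> perms V k. \<tau> i = j \<and> (\<forall>l\<in>V. \<tau> l \<noteq> \<sigma> l)}"
proof -
  define S where "S = V - {i}"
  define g where "g = transpose i j \<circ> \<sigma>"
  let ?N = "{\<tau> \<in> perms V k. \<tau> i = j \<and> (\<forall>l\<in>V. \<tau> l \<noteq> \<sigma> l)}"
  have S: "finite S" "i \<notin> S" "insert i S = V" "j \<in> insert i S" "card S = card V - 1"
    using V ij by (auto simp: S_def)
  have \<sigma>V: "\<sigma> permutes V" "num_cycles_on V \<sigma> = k" using \<sigma> by (auto simp: perms_def)
  have "inj g" unfolding g_def using permutes_inj[OF \<sigma>V(1)] by (intro inj_compose) auto
  then have g: "inj_on g S" by (rule inj_on_subset) auto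
  have "{l \<in> S. g l = l} \<subseteq> insert j {l \<in> V. \<sigma> l = l}"
  proof
    fix l assume "l \<in> {l \<in> S. g l = l}"
    then have l: "l \<in> V" "l \<noteq> i" "transpose i j (\<sigma> l) = l" by (auto simp: S_def g_def)
    show "l \<in> insert j {l \<in> V. \<sigma> l = l}"
    proof (cases "l = j")
      case False
      have "\<sigma> l = transpose i j l" using l(3) by (metis transpose_involutory)
      then show ?thesis using l False by simp
    qed simp
  qed
  then have "card {l \<in> S. g l = l} \<le> card (insert j {l \<in> V. \<sigma> l = l})"
    using V by (intro card_mono) auto
  also have "\<dots> \<le> Suc (card {l \<in> V. \<sigma> l = l})" by (rule card_insert_le_m1) auto
  also have "\<dots> \<le> k + 1" using card_fixed_points_le_num_cycles_on[OF V, of \<sigma>] \<sigma>V by simp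
  finally have fixed: "card {l \<in> S. g l = l} \<le> k + 1" .
  have "card (avoiders S g k') \<le> card ?N"
  proof (rule card_inj_on_le[where f = "\<lambda>p. transpose i j \<circ> p"])
    show "inj_on (\<lambda>p. transpose i j \<circ> p) (avoiders S g k')"
      by (rule inj_on_inverseI[where g = "\<lambda>p. transpose i j \<circ> p"]) (simp flip: comp_assoc)
    show "(\<lambda>p. transpose i j \<circ> p) ` avoiders S g k' \<subseteq> ?N"
    proof (rule image_subsetI)
      fix p assume p: "p \<in> avoiders S g k'"
      then have pS: "p \<in> perms S (k - (if i = j then 1 else 0))" by (simp add: avoiders_def k)
      have k1: "1 \<le> k" using k by (auto split: if_splits)
      note * = transpose_comp_in_perms_insert[OF S(1,2,4) k1 pS]
      have "(transpose i j \<circ> p) l \<noteq> \<sigma> l" if l: "l \<in> V" for l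
      proof (cases "l = i")
        case True
        then show ?thesis using *(2) \<sigma> by simp
      next
        case False
        then have "p l \<noteq> g l" using p l by (auto simp: avoiders_def S_def)
        then show ?thesis unfolding g_def by (metis comp_apply transpose_involutory)
      qed
      then show "transpose i j \<circ> p \<in> ?N" using *(1) *(2) unfolding S(3) by blast
    qed
    show "finite ?N" using V by simp
  qed
  then have le: "real (card (avoiders S g k')) \<le> real (card ?N)" by simp
  have "real (stirling (card S) k') \<le> 8 * (real (card S))\<^sup>2 * card (avoiders S g k')"
    by (rule card_avoiders_ge[OF S(1) g k(1) _ fixed]) (use k big S(5) in auto)
  also have "\<dots> \<le> 8 * (real (card V))\<^sup>2 * card ?N"
    using S(5) le by (intro mult_mono power_mono) auto
  finally show ?thesis by (simp add: S(5))
qed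

text \<open>\<open>e1\<close> settles the case of pairs, as there are at most \<open>n * M\<close>
  permutations in all. \<open>e2\<close> says that the exceptions to a star are outnumbered by the
  members of the star that one exception excludes.\<close>

lemma intersecting_perms_small_or_star:
  fixes b s r :: real and F :: "('a \<Rightarrow> 'a) set"
  assumes V: "finite V" "card V = n" and k: "1 \<le> k" and h: "2 * k \<le> h" "h \<le> n"
    and b: "b \<le> real h / (2 * real k)" and s: "1 \<le> s" "s \<le> b" "s ^ n \<le> b ^ (n - h)"
    and r: "1 \<le> r" "r \<le> s" "2 * real q \<le> r"
    and small: "2 * ((1 / 2) ^ t * (1 + 8 / r) ^ n + ((1 + 4 / r) ^ t - 1)) < 1 / 2"
    and e1: "((real q / s)\<^sup>2 + (r / s) ^ q) * real n < 1"
    and e2: "(r / s) ^ q * real n * (16 * (real n)\<^sup>2) < 1"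
    and big: "9 * (k + 1)\<^sup>2 \<le> n - 1"
    and F: "F \<subseteq> perms V k" and int: "\<And>p q. p \<in> F \<Longrightarrow> q \<in> F \<Longrightarrow> \<exists>x\<in>V. p x = q x"
  defines "M \<equiv> max (stirling (n - 1) k) (stirling (n - 1) (k - 1))"
  shows "card F < M \<or> (\<exists>i\<in>V. \<exists>j\<in>V. F \<subseteq> {p \<in> perms V k. p i = j})"
proof -
  let ?G = "perm_graph V" and ?A = "perm_graph V ` perms V k"
  define \<epsilon> where "\<epsilon> = (r / s) ^ q"
  have \<epsilon>0: "0 \<le> \<epsilon>" using r s by (simp add: \<epsilon>_def)
  have finF: "finite F" using F V(1) finite_subset finite_perms by metis
  have "k + 1 \<le> (k + 1)\<^sup>2" by (simp add: power2_eq_square)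
  then have kn: "k \<le> n - 1" "n \<ge> 1" using big by auto
  have "stirling (n - 1) k > 0" using k kn by (intro stirling_pos) auto
  then have M0: "real M > 0" by (simp add: M_def)
  have cA: "card ?A = stirling n k"
    using V by (simp add: card_perm_graph_image[OF order_refl] card_perms)
  \<comment> \<open>Sorting the permutations by their value at one point gives \<open>n - 1\<close>
    stars of one size and one star of the other.\<close>
  have AM: "real (card ?A) \<le> real n * real M"
  proof -
    obtain i where i: "k = Suc i" using k by (cases k) auto
    have "stirling n k = (n - 1) * stirling (n - 1) k + stirling (n - 1) (k - 1)"
      using kn i by (cases n) auto
    also have "\<dots> \<le> (n - 1) * M + M" by (intro add_mono mult_left_mono) (auto simp: M_def)
    also have "\<dots> = n * M" using kn by (cases n) auto
    finally have "real (stirling n k) \<le> real (n * M)" by (simp only: of_nat_le_iff)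
    then show ?thesis by (simp add: cA)
  qed
  have \<epsilon>n: "\<epsilon> * real n < 1 / 2"
  proof -
    have "1 \<le> (real n)\<^sup>2" using kn by simp
    then have "\<epsilon> * real n * 16 \<le> \<epsilon> * real n * (16 * (real n)\<^sup>2)"
      using \<epsilon>0 by (intro mult_left_mono) auto
    also have "\<dots> < 1" using e2 by (simp only: \<epsilon>_def)
    finally have "16 * (\<epsilon> * real n) < 1" by simp
    moreover have "0 \<le> \<epsilon> * real n" using \<epsilon>0 by simp
    ultimately show ?thesis by linarith
  qed
  have \<epsilon>A: "\<epsilon> * real (card ?A) \<le> \<epsilon> * real n * real M"
    using mult_left_mono[OF AM \<epsilon>0] by simp
  have sp: "spread 1 s ?A"
    using spread_perm_graphs[OF V(1) k h(1) _ b s(1,2)] h s V by simp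
  have AU: "?A \<subseteq> Pow (V \<times> V)"
    by (auto simp: perm_graph_def perms_def permutes_in_image)
  have sizes: "card S \<le> n" if "S \<in> ?A" for S
    using that V card_image_le[OF V(1)] by (auto simp: perm_graph_def)
  have "(\<exists>x. real (card {S \<in> ?G ` F. x \<notin> S}) \<le> (r / s) ^ q * real (card ?A)) \<or>
      real (card (?G ` F)) \<le> ((real q / s)\<^sup>2 + (r / s) ^ q) * real (card ?A)"
  proof (rule intersecting_subfamily_of_spread[OF _ AU sizes sp r small])
    fix S T assume "S \<in> ?G ` F" "T \<in> ?G ` F"
    then obtain p q where pq: "p \<in> F" "q \<in> F" "S = ?G p" "T = ?G q" by auto
    obtain x where "x \<in> V" "p x = q x" using int[OF pq(1,2)] by blast
    then have "(x, p x) \<in> S \<inter> T" using pq by (auto simp: perm_graph_def)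
    then show "S \<inter> T \<noteq> {}" by blast
  qed (use V F in auto)
  then consider (small) "real (card F) \<le> ((real q / s)\<^sup>2 + (r / s) ^ q) * real (card ?A)"
    | (dense) x where "real (card {S \<in> ?G ` F. x \<notin> S}) \<le> \<epsilon> * real (card ?A)"
    by (auto simp: card_perm_graph_image[OF F] \<epsilon>_def)
  then show ?thesis
  proof cases
    case small
    have "real (card F) \<le> ((real q / s)\<^sup>2 + (r / s) ^ q) * real (card ?A)" by (rule small)
    also have "\<dots> \<le> ((real q / s)\<^sup>2 + (r / s) ^ q) * (real n * real M)"
      using AM \<epsilon>0 by (intro mult_left_mono) (auto simp: \<epsilon>_def)
    also have "\<dots> = ((real q / s)\<^sup>2 + (r / s) ^ q) * real n * real M" by simp
    also have "\<dots> < 1 * real M" using e1 M0 by (intro mult_strict_right_mono) auto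
    finally show ?thesis by simp
  next
    case dense
    define F' where "F' = {p \<in> F. x \<notin> ?G p}"
    have "{S \<in> ?G ` F. x \<notin> S} = ?G ` F'" by (auto simp: F'_def)
    moreover have "card (?G ` F') = card F'" using F by (intro card_perm_graph_image[of _ _ k]) (auto simp: F'_def)
    ultimately have F': "real (card F') \<le> \<epsilon> * real n * real M" using dense \<epsilon>A by simp
    have F'M: "real (card F') < 1 / 2 * real M"
      using F' mult_strict_right_mono[OF \<epsilon>n M0] by linarith
    obtain i j where x: "x = (i, j)" by (cases x)
    show ?thesis
    proof (cases "i \<in> V \<and> j \<in> V")
      case False
      \<comment> \<open>No graph contains a pair outside \<open>V \<times> V\<close>, so all of
        \<open>F\<close> is exceptional and hence small.\<close>
      have "F' = F" using False F by (fastforce simp: F'_def x perm_graph_def perms_def permutes_in_image)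
      then have "real (card F) < real M" using F'M M0 by simp
      then show ?thesis by simp
    next
      case True
      then have ij: "i \<in> V" "j \<in> V" by auto
      have F'_eq: "F' = {p \<in> F. p i \<noteq> j}" using ij by (auto simp: F'_def x perm_graph_def)
      let ?st = "{p \<in> perms V k. p i = j}"
      define k' where "k' = k - (if i = j then 1 else 0)"
      have cst: "card ?st = stirling (n - 1) k'"
      proof -
        have "V = insert i (V - {i})" using ij by auto
        then show ?thesis
          using card_perms_fixed_value[of "V - {i}" i j k] V ij k
          by (simp add: card_perms k'_def)
      qed
      then have cstM: "card ?st \<le> M" by (simp add: M_def k'_def)
      show ?thesis
      proof (cases "F' = {}")
        case True
        then have "F \<subseteq> ?st" using F F'_eq by auto
        then show ?thesis using ij by blast
      next
        case False
        then obtain \<sigma> where \<sigma>: "\<sigma> \<in> F" "\<sigma> i \<noteq> j" using F'_eq by auto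
        define F1 where "F1 = {p \<in> F. p i = j}"
        have "F = F1 \<union> F'" by (auto simp: F1_def F'_eq)
        then have cF: "card F \<le> card F1 + card F'" using card_Un_le by metis
        \<comment> \<open>A star with at most \<open>M / 2\<close> members falls short at once, as
          \<open>F'\<close> has fewer than \<open>M / 2\<close>. For a larger star, bounds relative
          to its size become bounds relative to \<open>M\<close>, and the constant 8 doubles to the
          16 in \<open>e2\<close>.\<close>
        have "real (card F) < real M"
        proof (cases "real (card ?st) \<le> 1 / 2 * real M")
          case True
          have "card F1 \<le> card ?st" using F V by (intro card_mono) (auto simp: F1_def)
          then show ?thesis using cF True F'M by linarith
        next
          case False
          \<comment> \<open>\<open>k' = 0\<close> would mean \<open>k = 1\<close> and
            \<open>i = j\<close>. Such a star is empty, since a single cycle on at least two points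
            fixes nothing.\<close>
          have k'1: "1 \<le> k'"
          proof (rule ccontr)
            assume "\<not> 1 \<le> k'"
            then have "k' = 0" by simp
            moreover have "n - 1 \<ge> 1" using k kn by simp
            ultimately have "stirling (n - 1) k' = 0" by (cases "n - 1") auto
            then show False using False cst M0 by simp
          qed
          \<comment> \<open>These members of the star do not intersect \<open>\<sigma>\<close>, so
            \<open>F\<close> must omit all of them.\<close>
          define N where "N = {\<tau> \<in> perms V k. \<tau> i = j \<and> (\<forall>l\<in>V. \<tau> l \<noteq> \<sigma> l)}"
          have finN: "finite N" using V by (simp add: N_def)
          have "real (stirling (n - 1) k') \<le> 8 * (real n)\<^sup>2 * card N"
          proof -
            have "\<sigma> \<in> perms V k" using \<sigma>(1) F by blast
            from card_star_avoiding_ge[OF V(1) ij this \<sigma>(2) k'1 k'_def] big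
            show ?thesis unfolding N_def V(2) .
          qed
          then have "1 / 2 * real M < 8 * (real n)\<^sup>2 * card N" using False cst by simp
          then have N: "real M < 16 * (real n)\<^sup>2 * card N" by simp
          have sub: "F1 \<subseteq> ?st - N"
          proof
            fix \<tau> assume \<tau>: "\<tau> \<in> F1"
            then obtain l where "l \<in> V" "\<tau> l = \<sigma> l" using int \<sigma>(1) unfolding F1_def by blast
            then show "\<tau> \<in> ?st - N" using \<tau> F by (auto simp: F1_def N_def)
          qed
          have "card F1 \<le> card (?st - N)" using V by (intro card_mono sub) auto
          also have "\<dots> = card ?st - card N" using finN by (intro card_Diff_subset) (auto simp: N_def)
          finally have "card F1 \<le> card ?st - card N" .
          moreover have "card N \<le> card ?st" using V by (intro card_mono) (auto simp: N_def)
          ultimately have F1: "card F1 + card N \<le> M" using cstM by linarith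
          have "\<epsilon> * real n * real M \<le> \<epsilon> * real n * (16 * (real n)\<^sup>2 * card N)"
            using N \<epsilon>0 by (intro mult_left_mono) auto
          also have "\<dots> = (\<epsilon> * real n * (16 * (real n)\<^sup>2)) * card N" by simp
          also have "\<dots> < 1 * real (card N)"
          proof (rule mult_strict_right_mono)
            show "0 < real (card N)" using N M0 by (cases "card N = 0") auto
          qed (use e2 in \<open>simp add: \<epsilon>_def\<close>)
          finally have "real (card F') < card N" using F' by simp
          then show ?thesis using F1 cF by linarith
        qed
        then show ?thesis by simp
      qed
    qed
  qed
qed

section \<open>Parameters as powers of \<open>n\<close>\<close>

lemma fragment_bound:
  fixes r :: real
  assumes r: "r > 0" and t: "x \<le> real t" "real t \<le> x + 1"
    and small: "2 * (2 powr (- x) * exp (8 * real n / r) + (exp (4 * (x + 1) / r) - 1)) < 1 / 2"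
  shows "2 * ((1 / 2) ^ t * (1 + 8 / r) ^ n + ((1 + 4 / r) ^ t - 1)) < 1 / 2"
proof -
  have exp_bound: "(1 + y) ^ m \<le> exp (real m * y)" if "y \<ge> 0" for y :: real and m
  proof -
    have "(1 + y) ^ m \<le> exp y ^ m" using that by (intro power_mono exp_ge_add_one_self) auto
    then show ?thesis by (simp flip: exp_of_nat_mult)
  qed
  have "(1 / 2 :: real) ^ t = 2 powr (- real t)"
    by (simp add: powr_minus powr_realpow power_one_over inverse_eq_divide)
  also have "\<dots> \<le> 2 powr (- x)" using t by (intro powr_mono) auto
  finally have 1: "(1 / 2 :: real) ^ t \<le> 2 powr (- x)" .
  have "(1 + 8 / r) ^ n \<le> exp (8 * real n / r)"
    using exp_bound[of "8 / r" n] r by (simp add: mult.commute)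
  then have 2: "(1 / 2) ^ t * (1 + 8 / r) ^ n \<le> 2 powr (- x) * exp (8 * real n / r)"
    using 1 r by (intro mult_mono) auto
  have "(1 + 4 / r) ^ t \<le> exp (real t * (4 / r))" using exp_bound[of "4 / r" t] r by simp
  also have "\<dots> \<le> exp (4 * (x + 1) / r)" using t r by (simp add: divide_right_mono)
  finally have "(1 + 4 / r) ^ t \<le> exp (4 * (x + 1) / r)" .
  with 2 small show ?thesis by argo
qed

lemma card_Sym_cycles_star:
  assumes "i \<in> {1..n}" "j \<in> {1..n}" "1 \<le> k"
  shows "card {\<rho> \<in> Sym_cycles n k. \<rho> i = j} = stirling (n - 1) (k - (if i = j then 1 else 0))"
proof -
  have "{1..n} = insert i ({1..n} - {i})" using assms by auto
  then show ?thesis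
    using card_perms_fixed_value[of "{1..n} - {i}" i j k] assms
    by (simp add: card_perms Sym_cycles_eq_perms)
qed

lemma large_intersecting_family_in_star:
  "\<forall>\<^sub>F n in sequentially. \<forall>k F. 1 \<le> k \<longrightarrow> real k \<le> real n powr (1/4) \<longrightarrow>
    F \<subseteq> Sym_cycles n k \<longrightarrow> intersecting_family n F \<longrightarrow>
    card F < max (stirling (n - 1) k) (stirling (n - 1) (k - 1)) \<or>
    (\<exists>i\<in>{1..n}. \<exists>j\<in>{1..n}. F \<subseteq> {\<rho> \<in> Sym_cycles n k. \<rho> i = j})"
proof -
  \<comment> \<open>Any exponent below 3/4 would do here: the right-hand side is of order
    n^(3/4).\<close>
  have ev1: "\<forall>\<^sub>F n in sequentially. real n powr 0.74 \<le> (real n / 20 - 1) / (2 * real n powr (1/4))"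
    by real_asymp
  have ev2: "\<forall>\<^sub>F n in sequentially. 2 * real n powr (1/4) \<le> real n / 20 - 1"
    by real_asymp
  have ev3: "\<forall>\<^sub>F n in sequentially. 9 * (real n powr (1/4) + 1)\<^sup>2 \<le> real n - 1"
    by real_asymp
  have ev4: "\<forall>\<^sub>F n in sequentially. 80 \<le> real n powr 0.6"
    by real_asymp
  \<comment> \<open>The exponent \<open>8 * n^0.4\<close> is beaten by the n^0.5 halvings, and
    \<open>4 * n^0.5 / n^0.6\<close> tends to 0.\<close>
  have ev5: "\<forall>\<^sub>F n in sequentially. 2 * (2 powr (- (real n powr 0.5)) * exp (8 * real n / real n powr 0.6)
      + (exp (4 * (real n powr 0.5 + 1) / real n powr 0.6) - 1)) < 1 / 2"
    by real_asymp
  have ev6: "\<forall>\<^sub>F n in sequentially. ((40 / real n powr 0.7)\<^sup>2 + real n powr (-4)) * real n < 1"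
    by real_asymp
  have ev7: "\<forall>\<^sub>F n in sequentially. real n powr (-4) * real n * (16 * (real n)\<^sup>2) < 1"
    by real_asymp
  have ev8: "\<forall>\<^sub>F n in sequentially. 1 \<le> n" by (rule eventually_ge_at_top)
  show ?thesis
    using ev1 ev2 ev3 ev4 ev5 ev6 ev7 ev8
  proof eventually_elim
    case (elim n)
    show ?case
    proof (intro allI impI)
      fix k F
      assume k: "1 \<le> k" "real k \<le> real n powr (1/4)" and F: "F \<subseteq> Sym_cycles n k" "intersecting_family n F"
      \<comment> \<open>Spread n^0.74 holds for up to 19/20 of all values, and 0.74 * 0.95 = 0.703
        still exceeds 0.7, as \<open>sb\<close> requires.\<close>
      define m0 where "m0 = n div 20"
      \<comment> \<open>Rounding up is harmless: \<open>fragment_bound\<close> tolerates an error of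
        1 and replaces the discrete powers by the exponentials estimated above.\<close>
      define t where "t = nat \<lceil>real n powr 0.5\<rceil>"
      have m0: "real n / 20 - 1 \<le> real m0" "real m0 \<le> real n / 20" unfolding m0_def by linarith+
      have n1: "real n \<ge> 1" using elim(8) by simp
      have "real (2 * k) \<le> real m0" using elim(2) k m0 by simp
      then have m0k: "2 * k \<le> m0" by (simp only: of_nat_le_iff)
      have "real (9 * (k + 1)\<^sup>2) \<le> 9 * (real n powr (1/4) + 1)\<^sup>2"
        using k by (simp add: power_mono)
      also have "\<dots> \<le> real (n - 1)" using elim(3,8) by (simp add: of_nat_diff)
      finally have big: "9 * (k + 1)\<^sup>2 \<le> n - 1" by (simp only: of_nat_le_iff)
      have b: "real n powr 0.74 \<le> real m0 / (2 * real k)"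
      proof -
        have "0 \<le> real n / 20 - 1" using elim(2) powr_ge_zero[of "real n" "1/4"] by linarith
        then have "(real n / 20 - 1) / (2 * real n powr (1/4)) \<le> real m0 / (2 * real k)"
          using m0 k by (intro frac_le) auto
        with elim(1) show ?thesis by linarith
      qed
      have sb: "(real n powr 0.7) ^ n \<le> (real n powr 0.74) ^ (n - m0)"
      proof -
        have "real (n - m0) = real n - real m0" unfolding m0_def by (intro of_nat_diff) simp
        then have "0.7 * real n \<le> 0.74 * real (n - m0)" using m0 by simp
        then have "real n powr (0.7 * real n) \<le> real n powr (0.74 * real (n - m0))"
          using n1 by (intro powr_mono) auto
        then show ?thesis using n1 by (simp add: powr_powr flip: powr_realpow)
      qed
      \<comment> \<open>The choice of 40 gives exponent -4, one less than the -3 at which the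
        condition with \<open>16 * n^2\<close> would break down.\<close>
      have rs: "(real n powr 0.6 / real n powr 0.7) ^ 40 = real n powr (-4)"
      proof -
        have "(real n powr 0.6 / real n powr 0.7) ^ 40 = (real n powr (-0.1)) ^ 40"
          by (simp flip: powr_diff)
        also have "(real n powr (-0.1)) ^ 40 = (real n powr (-0.1)) powr real 40"
          using n1 by (intro powr_realpow[symmetric]) auto
        finally show ?thesis by (simp add: powr_powr)
      qed
      have small: "2 * ((1 / 2) ^ t * (1 + 8 / real n powr 0.6) ^ n + ((1 + 4 / real n powr 0.6) ^ t - 1)) < 1 / 2"
      proof (rule fragment_bound[where x = "real n powr 0.5"])
        have "0 \<le> real n powr 0.5" by simp
        then show "real n powr 0.5 \<le> real t" "real t \<le> real n powr 0.5 + 1"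
          unfolding t_def by linarith+
      qed (use n1 elim(5) in auto)
      have int: "\<exists>x\<in>{1..n}. p x = q x" if "p \<in> F" "q \<in> F" for p q
        using F(2) that by (auto simp: intersecting_family_def)
      show "card F < max (stirling (n - 1) k) (stirling (n - 1) (k - 1)) \<or>
          (\<exists>i\<in>{1..n}. \<exists>j\<in>{1..n}. F \<subseteq> {\<rho> \<in> Sym_cycles n k. \<rho> i = j})"
        unfolding Sym_cycles_eq_perms
      proof (rule intersecting_perms_small_or_star[where b = "real n powr 0.74" and s = "real n powr 0.7"
            and r = "real n powr 0.6" and q = 40 and t = t and h = m0])
        show "((real 40 / real n powr 0.7)\<^sup>2 + (real n powr 0.6 / real n powr 0.7) ^ 40) * real n < 1"
          using elim(6) unfolding rs by simp
        show "(real n powr 0.6 / real n powr 0.7) ^ 40 * real n * (16 * (real n)\<^sup>2) < 1"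
          using elim(7) unfolding rs .
        show "2 * real 40 \<le> real n powr 0.6" using elim(4) by simp
        show "1 \<le> real n powr 0.7" "1 \<le> real n powr 0.6" using n1 by (auto intro: ge_one_powr_ge_zero)
        show "real n powr 0.7 \<le> real n powr 0.74" "real n powr 0.6 \<le> real n powr 0.7"
          using n1 by (auto intro: powr_mono)
        show "real n powr 0.74 \<le> real m0 / (2 * real k)" by (rule b)
        show "(real n powr 0.7) ^ n \<le> (real n powr 0.74) ^ (n - m0)" by (rule sb)
        show "2 * ((1 / 2) ^ t * (1 + 8 / real n powr 0.6) ^ n + ((1 + 4 / real n powr 0.6) ^ t - 1)) < 1 / 2"
          by (rule small)
        show "F \<subseteq> perms {1..n} k" using F(1) by (simp add: Sym_cycles_eq_perms)
        show "m0 \<le> n" by (simp add: m0_def)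
      qed (use k m0k big int in simp_all)
    qed
  qed
qed

theorem corollary1p3:
  shows "\<exists>N::nat. \<forall>n\<ge>N. \<forall>k::nat. 1 \<le> k \<and> real k \<le> real n powr (1/4) \<longrightarrow>
    (\<forall>F::(nat \<Rightarrow> nat) set. F \<subseteq> Sym_cycles n k \<and> intersecting_family n F \<longrightarrow>
      card F \<le> max (stirling (n - 1) k) (stirling (n - 1) (k - 1)) \<and>
      (card F = max (stirling (n - 1) k) (stirling (n - 1) (k - 1)) \<longleftrightarrow>
        (\<exists>i\<in>{1..n}. \<exists>j\<in>{1..n}.
          F = {\<rho> \<in> Sym_cycles n k. \<rho> i = j} \<and>
          stirling (n - 1) (k - (if i = j then 1 else 0)) =
            max (stirling (n - 1) k) (stirling (n - 1) (k - 1)))))"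
proof -
  obtain N where N: "\<forall>n\<ge>N. \<forall>k F. 1 \<le> k \<longrightarrow> real k \<le> real n powr (1/4) \<longrightarrow>
      F \<subseteq> Sym_cycles n k \<longrightarrow> intersecting_family n F \<longrightarrow>
      card F < max (stirling (n - 1) k) (stirling (n - 1) (k - 1)) \<or>
      (\<exists>i\<in>{1..n}. \<exists>j\<in>{1..n}. F \<subseteq> {\<rho> \<in> Sym_cycles n k. \<rho> i = j})"
    using large_intersecting_family_in_star unfolding eventually_sequentially
    by (elim exE) (rule that)
  show ?thesis
  proof (rule exI[of _ N], intro allI impI)
    fix n k and F :: "(nat \<Rightarrow> nat) set"
    assume n: "N \<le> n" and k: "1 \<le> k \<and> real k \<le> real n powr (1/4)"
      and F: "F \<subseteq> Sym_cycles n k \<and> intersecting_family n F"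
    let ?M = "max (stirling (n - 1) k) (stirling (n - 1) (k - 1))"
    let ?star = "\<lambda>i j. {\<rho> \<in> Sym_cycles n k. \<rho> i = j}"
    have star: "card (?star i j) = stirling (n - 1) (k - (if i = j then 1 else 0))"
      if "i \<in> {1..n}" "j \<in> {1..n}" for i j
      using card_Sym_cycles_star that k by blast
    have "card F < ?M \<or> (\<exists>i\<in>{1..n}. \<exists>j\<in>{1..n}. F \<subseteq> ?star i j)"
      by (rule N[rule_format, OF n]) (use k F in auto)
    then consider "card F < ?M" | i j where "i \<in> {1..n}" "j \<in> {1..n}" "F \<subseteq> ?star i j"
      by blast
    then show "card F \<le> ?M \<and> (card F = ?M \<longleftrightarrow> (\<exists>i\<in>{1..n}. \<exists>j\<in>{1..n}.
        F = ?star i j \<and> stirling (n - 1) (k - (if i = j then 1 else 0)) = ?M))"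
    proof cases
      case 1
      have "\<not> (\<exists>i\<in>{1..n}. \<exists>j\<in>{1..n}. F = ?star i j \<and>
          stirling (n - 1) (k - (if i = j then 1 else 0)) = ?M)"
      proof (intro notI, elim bexE conjE)
        fix i j assume "i \<in> {1..n}" "j \<in> {1..n}" "F = ?star i j"
          "stirling (n - 1) (k - (if i = j then 1 else 0)) = ?M"
        then have "card F = ?M" using star by simp
        with 1 show False by simp
      qed
      with 1 show ?thesis by simp
    next
      case 2
      have fin: "finite (?star i j)" by (simp add: Sym_cycles_eq_perms)
      \<comment> \<open>In the chain \<open>card F\<close>, size of the star, \<open>?M\<close>,
        equality at the two ends forces equality throughout; so \<open>F\<close> is the whole star
        and the star has maximal size.\<close>
      have le: "card F \<le> card (?star i j)" using 2 fin by (intro card_mono)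
      have leM: "card (?star i j) \<le> ?M" using star[OF 2(1,2)] by simp
      have attained: "\<exists>i\<in>{1..n}. \<exists>j\<in>{1..n}. F = ?star i j \<and>
          stirling (n - 1) (k - (if i = j then 1 else 0)) = ?M" if M: "card F = ?M"
      proof (rule bexI[OF _ 2(1)], rule bexI[OF _ 2(2)], rule conjI)
        have c: "card (?star i j) = ?M" using le leM M by linarith
        then show "F = ?star i j" using M by (intro card_seteq[OF fin 2(3)]) simp
        show "stirling (n - 1) (k - (if i = j then 1 else 0)) = ?M"
          by (rule trans[OF star[OF 2(1,2), symmetric] c])
      qed
      have star_max: "card F = ?M" if "i' \<in> {1..n}" "j' \<in> {1..n}" "F = ?star i' j'"
          "stirling (n - 1) (k - (if i' = j' then 1 else 0)) = ?M" for i' j'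
        unfolding that(3) by (rule trans[OF star[OF that(1,2)] that(4)])
      show ?thesis
      proof (intro conjI iffI)
        show "card F \<le> ?M" by (rule order_trans[OF le leM])
        show "card F = ?M" if "\<exists>i\<in>{1..n}. \<exists>j\<in>{1..n}. F = ?star i j \<and>
            stirling (n - 1) (k - (if i = j then 1 else 0)) = ?M"
          using that by (elim bexE conjE) (rule star_max)
      qed (rule attained)
    qed
  qed
qed

end
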